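(* Let $p\ge5$ be a prime, $n\ge3$, $k=\mathbf F_p$, and let $T_N$, $H_a=G_{a+1}/G_N$, $\mathcal A_a(H_\bullet)$, $\mathcal I_a=\mathcal I_a^N$ and $\mathfrak D$ be as defined in the context. For every $N\ge3$, the following hold. (1) The canonical weighted filtration $$\Delta_{\mathbf Z}(T_N)=\mathcal A_1(H_\bullet)\supseteq\mathcal A_2(H_\bullet)\supseteq\cdots$$ is a multiplicative filtration (i.e. $\mathcal A_a(H_\bullet)\mathcal A_b(H_\bullet)\subseteq\mathcal A_{a+b}(H_\bullet)$) by two-sided ideals of $\mathbf Z[T_N]$, and $$\mathfrak D\bigl(\mathcal A_a(H_\bullet)\bigr)=H_a=G_{a+1}/G_N\qquad(a\ge1).$$ (2) The ideals defined by the jet action give a second multiplicative filtration $$\Delta_{\mathbf Z}(T_N)=\mathcal I_1\supseteq\mathcal I_2\supseteq\cdots$$ by two-sided ideals of $\mathbf Z[T_N]$ (with $\mathcal I_a\mathcal I_b\subseteq\mathcal I_{a+b}$) such that, for every $a\ge1$, $$\mathcal A_a(H_\bullet)\subseteq\mathcal I_a,\qquad \mathfrak D(\mathcal I_a)=G_{a+1}/G_N.$$ (3) If $N'\ge N$, the ring homomorphism $\mathbf Z[T_{N'}]\to\mathbf Z[T_N]$ induced by the quotient map $T_{N'}\to T_N$ sends $\mathcal I_a^{N'}$ into $\mathcal I_a^{N}$ for every $a\ge1$.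
   Context: Let $A=k[[x_1,\ldots,x_n]]$ with maximal ideal $\mathfrak m=(x_1,\ldots,x_n)$ and $\operatorname{vol}=dx_1\wedge\cdots\wedge dx_n$. $G$ is the group (under composition, $gh=g\circ h$) of continuous $k$-algebra automorphisms $g$ of $A$ with $g(x_j)-x_j\in\mathfrak m^2$ for all $j$ that preserve $\operatorname{vol}$, i.e. $\det(\partial g(x_i)/\partial x_j)=1$. For $s\ge2$, $G_s=\{g\in G: g(x_j)-x_j\in\mathfrak m^s\text{ for every }j\}$, a normal subgroup of $G=G_2$. For $N\ge3$, $T_N=G/G_N$ (a finite $p$-group). $G_s/G_N$ denotes the image $G_sG_N/G_N$ of $G_s$ in $T_N$ (trivial for $s\ge N$), and $H_a=G_{a+1}/G_N$ for $a\ge1$; so $H_1=T_N$. $\Delta_{\mathbf Z}(T_N)$ is the augmentation ideal of $\mathbf Z[T_N]$. For an ideal $J\subseteq\Delta_{\mathbf Z}(T_N)$, $\mathfrak D(J)=\{g\in T_N: g-1\in J\}$. For $a\ge1$, $\mathcal A_a(H_\bullet)$ is the additive subgroup of $\mathbf Z[T_N]$ generated by all products $(h_1-1)\cdots(h_t-1)$ with $t\ge1$, $h_i\in H_{b_i}$, $b_i\ge1$ and $\sum_i b_i\ge a$. Let $B_N=A/\mathfrak m^N$ with filtration $F^qB_N=(\mathfrak m^q+\mathfrak m^N)/\mathfrak m^N$, $q\ge0$. $T_N$ acts on $B_N$ by $k$-algebra automorphisms preserving this filtration, giving a ring homomorphism $\rho_{\mathbf Z}:\mathbf Z[T_N]\to\operatorname{End}_k(B_N)$.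 For $a\ge1$, $$\mathcal I_a=\mathcal I_a^N=\{z\in\Delta_{\mathbf Z}(T_N): \rho_{\mathbf Z}(z)(F^qB_N)\subseteq F^{q+a}B_N\text{ for all }q\ge0\}.$$ *)

theory Defs
  imports
    "HOL-Analysis.Determinants"
    "HOL-Algebra.Algebra"
    "HOL-Algebra.Algebraic_Closure_Type"
    "Berlekamp_Zassenhaus.Finite_Field"
begin

section \<open>Formal power series in finitely many variables\<close>

text \<open>
  The variables are indexed by the type \<open>'n\<close>, and a series is the family of its coefficients,
  indexed by the exponent vectors of the monomials.
\<close>

typedef ('n, 'k) mps = "UNIV :: (('n \<Rightarrow> nat) \<Rightarrow> 'k) set"
  morphisms mps_coeff Abs_mps
  by simp

setup_lifting type_definition_mps

lemma mps_eqI: "(\<And>m. mps_coeff f m = mps_coeff g m) \<Longrightarrow> f = g"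
  by transfer auto

definition exp_splits :: "('n \<Rightarrow> nat) \<Rightarrow> (('n \<Rightarrow> nat) \<times> ('n \<Rightarrow> nat)) set"
  where "exp_splits m = {(a, b). \<forall>i. a i + b i = m i}"

lemma finite_exp_splits [simp]: "finite (exp_splits (m :: 'n::finite \<Rightarrow> nat))"
proof -
  define E where "E = (PiE UNIV (\<lambda>i. {..m i}) :: ('n \<Rightarrow> nat) set)"
  have "finite E"
    unfolding E_def by (rule finite_PiE) auto
  moreover have "exp_splits m \<subseteq> E \<times> E"
    by (auto simp: exp_splits_def E_def PiE_def Pi_def extensional_def) (metis le_add1 le_add2)+
  ultimately show ?thesis
    by (meson finite_SigmaI finite_subset)
qed

lemma sum_exp_splits_assoc:
  fixes m :: "'n::finite \<Rightarrow> nat" and F :: "_ \<Rightarrow> _ \<Rightarrow> _ \<Rightarrow> 'b::comm_monoid_add"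
  shows "(\<Sum>(u, c)\<in>exp_splits m. \<Sum>(a, b)\<in>exp_splits u. F a b c) =
         (\<Sum>(a, v)\<in>exp_splits m. \<Sum>(b, c)\<in>exp_splits v. F a b c)"
proof -
  have "(\<Sum>(u, c)\<in>exp_splits m. \<Sum>(a, b)\<in>exp_splits u. F a b c) =
        (\<Sum>(p, q)\<in>Sigma (exp_splits m) (\<lambda>p. exp_splits (fst p)). F (fst q) (snd q) (snd p))"
    by (subst sum.Sigma [symmetric]) (auto simp: split_beta)
  also have "\<dots> = (\<Sum>(p, q)\<in>Sigma (exp_splits m) (\<lambda>p. exp_splits (snd p)).
                     F (fst p) (fst q) (snd q))"
    by (rule sum.reindex_bij_witness
          [where i = "\<lambda>((a, v), (b, c)). ((\<lambda>i. a i + b i, c), (a, b))"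
             and j = "\<lambda>((u, c), (a, b)). ((a, \<lambda>i. b i + c i), (b, c))"])
       (auto simp: exp_splits_def fun_eq_iff, (metis add.assoc)+)
  also have "\<dots> = (\<Sum>(a, v)\<in>exp_splits m. \<Sum>(b, c)\<in>exp_splits v. F a b c)"
    by (subst sum.Sigma [symmetric]) (auto simp: split_beta)
  finally show ?thesis .
qed

definition mps_const :: "'k::zero \<Rightarrow> ('n, 'k) mps"
  where "mps_const c = Abs_mps (\<lambda>m. if m = (\<lambda>_. 0) then c else 0)"

definition mps_X :: "'n \<Rightarrow> ('n, 'k::zero_neq_one) mps"
  where "mps_X j = Abs_mps (\<lambda>m. if m = (\<lambda>i. if i = j then 1 else 0) then 1 else 0)"

definition mps_pderiv :: "'n \<Rightarrow> ('n, 'k::semiring_1) mps \<Rightarrow> ('n, 'k) mps"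
  where "mps_pderiv j f = Abs_mps (\<lambda>m. of_nat (m j + 1) * mps_coeff f (m(j := m j + 1)))"

instantiation mps :: (finite, comm_ring_1) comm_ring_1
begin

definition "0 = mps_const 0"
definition "1 = mps_const 1"
definition "f + g = Abs_mps (\<lambda>m. mps_coeff f m + mps_coeff g m)"
definition "f - g = Abs_mps (\<lambda>m. mps_coeff f m - mps_coeff g m)"
definition "- f = Abs_mps (\<lambda>m. - mps_coeff f m)"
definition "f * g = Abs_mps (\<lambda>m. \<Sum>(a, b)\<in>exp_splits m. mps_coeff f a * mps_coeff g b)"

lemma mps_coeff_simps [simp]:
  fixes f g :: "('a, 'b) mps"
  shows "mps_coeff (0 :: ('a, 'b) mps) m = 0"
    "mps_coeff (1 :: ('a, 'b) mps) m = (if m = (\<lambda>_. 0) then 1 else 0)"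
    "mps_coeff (f + g) m = mps_coeff f m + mps_coeff g m"
    "mps_coeff (f - g) m = mps_coeff f m - mps_coeff g m"
    "mps_coeff (- f) m = - mps_coeff f m"
  by (simp_all add: zero_mps_def one_mps_def plus_mps_def minus_mps_def uminus_mps_def
      mps_const_def Abs_mps_inverse)

lemma mps_coeff_mult:
  fixes f g :: "('a, 'b) mps"
  shows "mps_coeff (f * g) m = (\<Sum>(a, b)\<in>exp_splits m. mps_coeff f a * mps_coeff g b)"
  by (simp add: times_mps_def Abs_mps_inverse)

instance
proof
  fix f g h :: "('a, 'b) mps"
  show "f * g * h = f * (g * h)"
  proof (rule mps_eqI)
    fix m
    have "mps_coeff (f * g * h) m = (\<Sum>(u, c)\<in>exp_splits m. \<Sum>(a, b)\<in>exp_splits u.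
            mps_coeff f a * mps_coeff g b * mps_coeff h c)"
      by (simp add: mps_coeff_mult sum_distrib_right split_beta)
    also have "\<dots> = (\<Sum>(a, v)\<in>exp_splits m. \<Sum>(b, c)\<in>exp_splits v.
            mps_coeff f a * mps_coeff g b * mps_coeff h c)"
      by (rule sum_exp_splits_assoc)
    also have "\<dots> = mps_coeff (f * (g * h)) m"
      by (simp add: mps_coeff_mult sum_distrib_left split_beta mult.assoc)
    finally show "mps_coeff (f * g * h) m = mps_coeff (f * (g * h)) m" .
  qed
  show "f * g = g * f"
  proof (rule mps_eqI)
    fix m
    show "mps_coeff (f * g) m = mps_coeff (g * f) m"
      unfolding mps_coeff_mult
      by (rule sum.reindex_bij_witness [where i = prod.swap and j = prod.swap])
         (auto simp: exp_splits_def add.commute mult.commute)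
  qed
  show "1 * f = f"
  proof (rule mps_eqI)
    fix m
    have "mps_coeff (1 * f) m = (\<Sum>(a, b)\<in>{(\<lambda>_. 0, m)}. mps_coeff 1 a * mps_coeff f b)"
      unfolding mps_coeff_mult
    proof (rule sum.mono_neutral_right)
      show "finite (exp_splits m)"
        by simp
    qed (auto simp: exp_splits_def fun_eq_iff split: if_splits)
    then show "mps_coeff (1 * f) m = mps_coeff f m"
      by simp
  qed
  show "(f + g) * h = f * h + g * h"
    by (rule mps_eqI) (simp add: mps_coeff_mult split_beta distrib_right sum.distrib)
  show "f + g + h = f + (g + h)" "f + g = g + f" "0 + f = f" "- f + f = 0" "f - g = f + - g"
    by (auto intro!: mps_eqI simp: add_ac)
  show "(0 :: ('a, 'b) mps) \<noteq> 1"
  proof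
    assume "(0 :: ('a, 'b) mps) = 1"
    then have "mps_coeff (0 :: ('a, 'b) mps) (\<lambda>_. 0) = mps_coeff (1 :: ('a, 'b) mps) (\<lambda>_. 0)"
      by simp
    then show False
      by simp
  qed
qed

end

text \<open>The ring \<open>A\<close>, its maximal ideal, and the powers of the latter (as products of ideals).\<close>

abbreviation mps_ring :: "('n::finite, 'k::comm_ring_1) mps ring"
  where "mps_ring \<equiv> ring_of_type_algebra"

definition mps_max :: "('n::finite, 'k::comm_ring_1) mps set"
  where "mps_max = Idl\<^bsub>mps_ring\<^esub> (range mps_X)"

primrec mps_max_pow :: "nat \<Rightarrow> ('n::finite, 'k::comm_ring_1) mps set"
  where
    "mps_max_pow 0 = carrier mps_ring"
  | "mps_max_pow (Suc s) = mps_max \<cdot>\<^bsub>mps_ring\<^esub> mps_max_pow s"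


section \<open>Volume-preserving automorphisms and the groups of jets\<close>

type_synonym ('n, 'k) mps_map = "('n, 'k) mps \<Rightarrow> ('n, 'k) mps"

definition adic_continuous :: "('n::finite, 'k::comm_ring_1) mps_map \<Rightarrow> bool"
  where "adic_continuous g \<longleftrightarrow>
    (\<forall>f s. \<exists>t. \<forall>h. h - f \<in> mps_max_pow t \<longrightarrow> g h - g f \<in> mps_max_pow s)"

definition continuous_automorphisms :: "('n::finite, 'k::comm_ring_1) mps_map set"
  where "continuous_automorphisms =
    {g \<in> ring_iso mps_ring mps_ring. (\<forall>c. g (mps_const c) = mps_const c) \<and> adic_continuous g}"

definition jacobian :: "('n::finite, 'k::comm_ring_1) mps_map \<Rightarrow> ('n, 'k) mps ^ 'n ^ 'n"
  where "jacobian g = (\<chi> i j. mps_pderiv j (g (mps_X i)))"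

definition vol_group :: "('n::finite, 'k::comm_ring_1) mps_map monoid"
  where "vol_group =
    \<lparr>carrier = {g \<in> continuous_automorphisms.
        (\<forall>j. g (mps_X j) - mps_X j \<in> mps_max_pow 2) \<and> det (jacobian g) = 1},
     monoid.mult = (\<circ>), one = id\<rparr>"

definition vol_subgroup :: "nat \<Rightarrow> ('n::finite, 'k::comm_ring_1) mps_map set"
  where "vol_subgroup s =
    {g \<in> carrier vol_group. \<forall>j. g (mps_X j) - mps_X j \<in> mps_max_pow s}"

definition jet_group :: "nat \<Rightarrow> ('n::finite, 'k::comm_ring_1) mps_map set monoid"
  where "jet_group N = vol_group Mod vol_subgroup N"

text \<open>\<open>jet_subgroup N s\<close> is \<open>G\<^sub>s/G\<^sub>N\<close>, that is, the image of \<open>G\<^sub>s\<close> in \<open>T\<^sub>N\<close>.\<close>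

definition jet_subgroup :: "nat \<Rightarrow> nat \<Rightarrow> ('n::finite, 'k::comm_ring_1) mps_map set set"
  where "jet_subgroup N s = (\<lambda>g. vol_subgroup N #>\<^bsub>vol_group\<^esub> g) ` vol_subgroup s"

definition jet_weight :: "nat \<Rightarrow> nat \<Rightarrow> ('n::finite, 'k::comm_ring_1) mps_map set set"
  where "jet_weight N a = jet_subgroup N (a + 1)"

text \<open>The quotient map \<open>T\<^sub>N\<^sub>' \<rightarrow> T\<^sub>N\<close> (for \<open>N \<le> N'\<close>) does not mention \<open>N'\<close>: it sends a coset \<open>C\<close> to
  the common \<open>G\<^sub>N\<close>-coset of all elements of \<open>C\<close>.\<close>

definition jet_quotient ::
    "nat \<Rightarrow> ('n::finite, 'k::comm_ring_1) mps_map set \<Rightarrow> ('n, 'k) mps_map set"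
  where "jet_quotient N C = the_elem ((\<lambda>g. vol_subgroup N #>\<^bsub>vol_group\<^esub> g) ` C)"


section \<open>Integral group rings\<close>

definition group_ring :: "('g, 'm) monoid_scheme \<Rightarrow> ('g \<Rightarrow>\<^sub>0 int) ring"
  where "group_ring T =
    \<lparr>carrier = {z. Poly_Mapping.keys z \<subseteq> carrier T},
     monoid.mult = (\<lambda>y z. frag_extend (\<lambda>g. frag_extend (\<lambda>h. frag_of (g \<otimes>\<^bsub>T\<^esub> h)) z) y),
     one = frag_of \<one>\<^bsub>T\<^esub>,
     ring.zero = 0,
     add = (+)\<rparr>"

definition augmentation :: "('g \<Rightarrow>\<^sub>0 int) \<Rightarrow> int"
  where "augmentation z = (\<Sum>g\<in>Poly_Mapping.keys z. Poly_Mapping.lookup z g)"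

definition aug_ideal :: "('g, 'm) monoid_scheme \<Rightarrow> ('g \<Rightarrow>\<^sub>0 int) set"
  where "aug_ideal T = {z \<in> carrier (group_ring T). augmentation z = 0}"

definition group_ring_diff :: "('g, 'm) monoid_scheme \<Rightarrow> 'g \<Rightarrow> ('g \<Rightarrow>\<^sub>0 int)"
  where "group_ring_diff T g = frag_of g \<ominus>\<^bsub>group_ring T\<^esub> \<one>\<^bsub>group_ring T\<^esub>"

definition dim_subgroup :: "('g, 'm) monoid_scheme \<Rightarrow> ('g \<Rightarrow>\<^sub>0 int) set \<Rightarrow> 'g set"
  where "dim_subgroup T J = {g \<in> carrier T. group_ring_diff T g \<in> J}"

definition group_ring_map :: "('g \<Rightarrow> 'h) \<Rightarrow> ('g \<Rightarrow>\<^sub>0 int) \<Rightarrow> ('h \<Rightarrow>\<^sub>0 int)"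
  where "group_ring_map f = frag_extend (\<lambda>g. frag_of (f g))"

text \<open>A generator \<open>(h\<^sub>1 - 1) \<dots> (h\<^sub>t - 1)\<close> is given by the nonempty list of the pairs \<open>(b\<^sub>i, h\<^sub>i)\<close>.\<close>

definition weighted_ideal ::
    "('g, 'm) monoid_scheme \<Rightarrow> (nat \<Rightarrow> 'g set) \<Rightarrow> nat \<Rightarrow> ('g \<Rightarrow>\<^sub>0 int) set"
  where "weighted_ideal T H a = generate (add_monoid (group_ring T))
    {foldr (\<otimes>\<^bsub>group_ring T\<^esub>) (map (\<lambda>(b, h). group_ring_diff T h) bhs) \<one>\<^bsub>group_ring T\<^esub> | bhs.
       bhs \<noteq> [] \<and> (\<forall>(b, h)\<in>set bhs. b \<ge> 1 \<and> h \<in> H b) \<and> sum_list (map fst bhs) \<ge> a}"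


section \<open>The action on jets of functions\<close>

definition jet_ring :: "nat \<Rightarrow> ('n::finite, 'k::comm_ring_1) mps set ring"
  where "jet_ring N = mps_ring Quot mps_max_pow N"

definition jet_filtration :: "nat \<Rightarrow> nat \<Rightarrow> ('n::finite, 'k::comm_ring_1) mps set set"
  where "jet_filtration N q = (\<lambda>f. mps_max_pow N +>\<^bsub>mps_ring\<^esub> f) `
    (mps_max_pow q <+>\<^bsub>mps_ring\<^esub> mps_max_pow N)"

text \<open>The class \<open>C\<close> of \<open>g\<close> sends the class \<open>b\<close> of \<open>f\<close> to the class of \<open>g f\<close>.\<close>

definition jet_action ::
    "nat \<Rightarrow> ('n::finite, 'k::comm_ring_1) mps_map set \<Rightarrow> ('n, 'k) mps set \<Rightarrow> ('n, 'k) mps set"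
  where "jet_action N C b = the_elem {mps_max_pow N +>\<^bsub>mps_ring\<^esub> g f | g f. g \<in> C \<and> f \<in> b}"

definition jet_rep ::
    "nat \<Rightarrow> (('n::finite, 'k::comm_ring_1) mps_map set \<Rightarrow>\<^sub>0 int) \<Rightarrow> ('n, 'k) mps set \<Rightarrow> ('n, 'k) mps set"
  where "jet_rep N z b =
    (\<Oplus>\<^bsub>jet_ring N\<^esub>C\<in>Poly_Mapping.keys z. [Poly_Mapping.lookup z C] \<cdot>\<^bsub>jet_ring N\<^esub> jet_action N C b)"

definition jet_ideal ::
    "nat \<Rightarrow> nat \<Rightarrow> (('n::finite, 'k::comm_ring_1) mps_map set \<Rightarrow>\<^sub>0 int) set"
  where "jet_ideal N a =
    {z \<in> aug_ideal (jet_group N). \<forall>q. jet_rep N z ` jet_filtration N q \<subseteq> jet_filtration N (q + a)}"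

end

theory Submission
  imports Defs
begin

text \<open>
  An automorphism \<open>g\<close> with \<open>g x\<^sub>j - x\<^sub>j \<in> \<mm>\<^bsup>a+1\<^esup>\<close> for all \<open>j\<close> satisfies \<open>(g - 1) \<mm>\<^sup>q \<subseteq> \<mm>\<^bsup>q+a\<^esup>\<close>
  for all \<open>q\<close>. Hence \<open>h - 1\<close> with \<open>h \<in> H\<^sub>b\<close> raises the filtration of \<open>B\<^sub>N\<close> by \<open>b\<close>, a product of weight at
  least \<open>a\<close> raises it by \<open>a\<close>, and the weighted ideal of index \<open>a\<close> lies in the jet ideal of index \<open>a\<close>.
  Conversely, if the class of \<open>g - 1\<close> lies in the jet ideal, evaluating it at the variables (\<open>q = 1\<close>)
  shows \<open>g \<in> G\<^bsub>a+1\<^esub>\<close> modulo \<open>G\<^sub>N\<close>; so both filtrations cut out \<open>H\<^sub>a\<close>.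
\<close>

section \<open>The adic filtration on power series\<close>

text \<open>The definitions speak of ideal products, cosets and the quotient of \<open>A\<close> by
  m^N; the arguments replace all three by concrete tests in \<open>A\<close>. Powers of m are
  recognised by vanishing coefficients, elements of \<open>T_N\<close> by congruence of maps modulo
  m^N, and a group ring element acts on \<open>A\<close> itself through chosen coset
  representatives. That action is multiplicative only up to m^N, so every estimate is truncated at
  exponent \<open>min (q + a) N\<close>. That G is a group at all has to be proved. The determinant
  condition needs a chain rule for endomorphisms given only by algebraic axioms, not by
  substitution; inverses need that g, being the identity modulo higher order, neither raises nor
  lowers the order of a series. The ideals A_a are never computed. The inclusions H_a in D(A_a) in
  D(I_a) in H_a close up, and the last one needs only the action on the variables.\<close>

lemma type_ring_simps [simp]:
  "carrier (ring_of_type_algebra :: 'a::comm_ring_1 ring) = UNIV"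
  "monoid.mult (ring_of_type_algebra :: 'a ring) = (*)"
  "one (ring_of_type_algebra :: 'a ring) = 1"
  "ring.zero (ring_of_type_algebra :: 'a ring) = 0"
  "add (ring_of_type_algebra :: 'a ring) = (+)"
  by (simp_all add: ring_of_type_algebra_def)

lemma mps_coeff_sum: "mps_coeff (\<Sum>i\<in>I. F i) m = (\<Sum>i\<in>I. mps_coeff (F i) m)"
  for F :: "'i \<Rightarrow> ('n::finite, 'k::comm_ring_1) mps"
  by (induction I rule: infinite_finite_induct) auto

lemma mps_coeff_const: "mps_coeff (mps_const c) m = (if m = (\<lambda>_. 0) then c else 0)"
  by (simp add: mps_const_def Abs_mps_inverse)

lemma mps_coeff_X: "mps_coeff (mps_X j) m = (if m = (\<lambda>i. if i = j then 1 else 0) then 1 else 0)"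
  by (simp add: mps_X_def Abs_mps_inverse)

lemma mps_coeff_pderiv: "mps_coeff (mps_pderiv j f) m = of_nat (m j + 1) * mps_coeff f (m(j := m j + 1))"
  by (simp add: mps_pderiv_def Abs_mps_inverse)

lemma mps_coeff_X_mult:
  fixes f :: "('n::finite, 'k::comm_ring_1) mps"
  shows "mps_coeff (mps_X j * f) m = (if m j = 0 then 0 else mps_coeff f (m(j := m j - 1)))"
proof (cases "m j = 0")
  case True
  then have "(a, b) \<in> exp_splits m \<Longrightarrow> a \<noteq> (\<lambda>i. if i = j then 1 else 0)" for a b
    by (auto simp: exp_splits_def dest!: spec[of _ j])
  then show ?thesis
    using True by (auto simp: mps_coeff_mult mps_coeff_X split_beta intro!: sum.neutral)
next
  case False
  let ?e = "\<lambda>i. if i = j then 1 else 0 :: nat"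
  have "mps_coeff (mps_X j * f) m =
      (\<Sum>(a, b)\<in>{(?e, m(j := m j - 1))}. mps_coeff (mps_X j) a * mps_coeff f b)"
    unfolding mps_coeff_mult
  proof (rule sum.mono_neutral_right)
    show "\<forall>i\<in>exp_splits m - {(?e, m(j := m j - 1))}.
        (case i of (a, b) \<Rightarrow> mps_coeff (mps_X j) a * mps_coeff f b) = 0"
    proof
      fix p
      assume "p \<in> exp_splits m - {(?e, m(j := m j - 1))}"
      moreover obtain a b where p: "p = (a, b)"
        by force
      ultimately have ab: "\<forall>i. a i + b i = m i" "(a, b) \<noteq> (?e, m(j := m j - 1))"
        by (auto simp: exp_splits_def)
      have "a \<noteq> ?e"
      proof
        assume a: "a = ?e"
        have "b = (\<lambda>i. m i - a i)"
          using ab(1) by (metis diff_add_inverse)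
        also have "\<dots> = m(j := m j - 1)"
          by (simp add: a fun_eq_iff)
        finally show False
          using a ab(2) by simp
      qed
      then show "(case p of (a, b) \<Rightarrow> mps_coeff (mps_X j) a * mps_coeff f b) = 0"
        by (simp add: p mps_coeff_X)
    qed
    show "finite (exp_splits m)"
      by simp
  qed (use False in \<open>auto simp: exp_splits_def\<close>)
  then show ?thesis
    using False by (simp add: mps_coeff_X)
qed

text \<open>Coefficientwise model of m^s: no monomial of total degree below s occurs. It turns
  membership into a pointwise test and is identified with the ideal power in
  \<open>mps_max_pow_eq_order_ge\<close>.\<close>

definition mps_order_ge :: "nat \<Rightarrow> ('n::finite, 'k::comm_ring_1) mps set"
  where "mps_order_ge s = {f. \<forall>m. sum m UNIV < s \<longrightarrow> mps_coeff f m = 0}"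

lemma mps_order_ge_mult:
  assumes "f \<in> mps_order_ge s" "g \<in> mps_order_ge t"
  shows "f * g \<in> mps_order_ge (s + t)"
proof -
  have "mps_coeff f a * mps_coeff g b = 0"
    if "sum m UNIV < s + t" "(a, b) \<in> exp_splits m" for m a b
  proof -
    have "sum m UNIV = sum a UNIV + sum b UNIV"
      using that(2) by (simp add: exp_splits_def flip: sum.distrib)
    then have "sum a UNIV < s \<or> sum b UNIV < t"
      using that(1) by linarith
    then show ?thesis
      using assms by (auto simp: mps_order_ge_def)
  qed
  then show ?thesis
    by (auto simp: mps_order_ge_def mps_coeff_mult split_beta intro!: sum.neutral)
qed

lemma mps_order_ge_0 [simp]: "mps_order_ge 0 = UNIV"
  by (simp add: mps_order_ge_def)

lemma ideal_mps_order_ge: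
  "ideal (mps_order_ge s) (mps_ring :: ('n::finite, 'k::comm_ring_1) mps ring)"
proof (rule idealI)
  show R: "ring (mps_ring :: ('n, 'k) mps ring)"
    by (rule ring_from_type_algebra)
  interpret ring "mps_ring :: ('n, 'k) mps ring" by fact
  have "\<ominus>\<^bsub>mps_ring\<^esub> f = - f" for f :: "('n, 'k) mps"
    by (rule minus_equality) auto
  then show "subgroup (mps_order_ge s) (add_monoid (mps_ring :: ('n, 'k) mps ring))"
    by unfold_locales (auto simp: mps_order_ge_def a_inv_def)
  fix f g :: "('n, 'k) mps"
  assume "f \<in> mps_order_ge s"
  then show "g \<otimes>\<^bsub>mps_ring\<^esub> f \<in> mps_order_ge s" "f \<otimes>\<^bsub>mps_ring\<^esub> g \<in> mps_order_ge s"
    using mps_order_ge_mult[of f s g 0] by (simp_all add: mult.commute)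
qed

text \<open>Each monomial of \<open>f\<close> is charged to one of the variables dividing it.\<close>

lemma mps_order_ge_decompose:
  fixes f :: "('n::finite, 'k::comm_ring_1) mps"
  assumes "f \<in> mps_order_ge (Suc s)"
  obtains F where "\<And>i. F i \<in> mps_order_ge s" "f = (\<Sum>i\<in>UNIV. mps_X i * F i)"
proof -
  define v :: "('n \<Rightarrow> nat) \<Rightarrow> 'n" where "v m = (SOME i. m i \<noteq> 0)" for m
  have v: "m (v m) \<noteq> 0" if "m \<noteq> (\<lambda>_. 0)" for m
    unfolding v_def using that by (intro someI_ex[of "\<lambda>i. m i \<noteq> 0"]) auto
  define F where
    "F i = Abs_mps (\<lambda>m. if v (m(i := m i + 1)) = i then mps_coeff f (m(i := m i + 1)) else 0)" for i
  have cF: "mps_coeff (F i) m =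
      (if v (m(i := m i + 1)) = i then mps_coeff f (m(i := m i + 1)) else 0)" for i m
    by (simp add: F_def Abs_mps_inverse)
  show thesis
  proof
    fix i
    have "sum (m(i := m i + 1)) UNIV = sum m UNIV + 1" for m :: "'n \<Rightarrow> nat"
      by (simp add: sum.remove[of UNIV i])
    then show "F i \<in> mps_order_ge s"
      using assms by (auto simp: mps_order_ge_def cF)
  next
    show "f = (\<Sum>i\<in>UNIV. mps_X i * F i)"
    proof (rule mps_eqI)
      fix m
      have *: "mps_coeff (mps_X i * F i) m = (if i = v m then (if m i = 0 then 0 else mps_coeff f m) else 0)" for i
        by (auto simp: mps_coeff_X_mult cF)
      have "mps_coeff f m = 0" if "m = (\<lambda>_. 0)"
        using assms that by (auto simp: mps_order_ge_def)
      then show "mps_coeff f m = mps_coeff (\<Sum>i\<in>UNIV. mps_X i * F i) m"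
        using v[of m]
        by (cases "m = (\<lambda>_. 0)") (simp add: mps_coeff_sum mps_coeff_X_mult, simp add: mps_coeff_sum *)
    qed
  qed
qed

lemma mps_X_order: "mps_X i \<in> mps_order_ge (Suc 0)"
  by (auto simp: mps_order_ge_def mps_coeff_X)

text \<open>An ideal product consists of finite sums only, whereas a series has infinitely many
  monomials. Finiteness of the set of variables resolves this: grouping the monomials by a variable
  dividing them leaves one product X_i F_i per variable.\<close>

lemma mps_max_pow_eq_order_ge: "mps_max_pow s = mps_order_ge s"
proof (induction s)
  case (Suc s)
  interpret R: ring "mps_ring :: ('a, 'b) mps ring"
    by (rule ring_from_type_algebra)
  interpret ideal "mps_max :: ('a, 'b) mps set" mps_ring
    unfolding mps_max_def by (rule R.genideal_ideal) auto
  have max: "mps_max \<subseteq> (mps_order_ge 1 :: ('a, 'b) mps set)"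
    unfolding mps_max_def by (rule R.genideal_minimal) (auto intro: ideal_mps_order_ge mps_X_order)
  have X: "mps_X i \<in> (mps_max :: ('a, 'b) mps set)" for i
    unfolding mps_max_def using R.genideal_self[of "range mps_X"] by auto
  interpret O: ideal "mps_order_ge (Suc s) :: ('a, 'b) mps set" mps_ring
    by (rule ideal_mps_order_ge)
  have "f \<in> mps_order_ge (Suc s)" if "f \<in> mps_max \<cdot>\<^bsub>mps_ring\<^esub> mps_order_ge s" for f :: "('a, 'b) mps"
    using that
  proof induction
    case (prod i j)
    then show ?case
      using max mps_order_ge_mult[of i 1 j s] by auto
  next
    case (sum s1 s2)
    then show ?case
      by (intro O.a_closed)
  qed
  moreover have "f \<in> mps_max \<cdot>\<^bsub>mps_ring\<^esub> mps_order_ge s"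
    if f: "f \<in> mps_order_ge (Suc s)" for f :: "('a, 'b) mps"
  proof -
    interpret P: ideal "mps_max \<cdot>\<^bsub>mps_ring\<^esub> mps_order_ge s :: ('a, 'b) mps set" mps_ring
      by (intro R.ideal_prod_is_ideal ideal_mps_order_ge) unfold_locales
    obtain F where F: "\<And>i. F i \<in> mps_order_ge s" "f = (\<Sum>i\<in>UNIV. mps_X i * F i)"
      using mps_order_ge_decompose[OF f] by blast
    have gen: "mps_X i * F i \<in> mps_max \<cdot>\<^bsub>mps_ring\<^esub> mps_order_ge s" for i
      using ideal_prod.prod[OF X F(1), where R = mps_ring] by simp
    have "(\<Sum>i\<in>I. mps_X i * F i) \<in> mps_max \<cdot>\<^bsub>mps_ring\<^esub> mps_order_ge s" for I
      using P.zero_closed P.a_closed gen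
      by (induction I rule: infinite_finite_induct) auto
    then show ?thesis
      using F(2) by simp
  qed
  ultimately show ?case
    unfolding mps_max_pow.simps Suc.IH by blast
qed simp

lemma ideal_mps_max_pow: "ideal (mps_max_pow s) mps_ring"
  unfolding mps_max_pow_eq_order_ge by (rule ideal_mps_order_ge)

lemma mps_max_pow_0_eq [simp]: "mps_max_pow 0 = UNIV"
  by simp

declare mps_max_pow.simps [simp del]

lemma mps_max_pow_zero [simp]: "0 \<in> mps_max_pow s"
  and mps_max_pow_add: "f \<in> mps_max_pow s \<Longrightarrow> g \<in> mps_max_pow s \<Longrightarrow> f + g \<in> mps_max_pow s"
  and mps_max_pow_diff: "f \<in> mps_max_pow s \<Longrightarrow> g \<in> mps_max_pow s \<Longrightarrow> f - g \<in> mps_max_pow s"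
  and mps_max_pow_minus: "f \<in> mps_max_pow s \<Longrightarrow> - f \<in> mps_max_pow s"
  by (auto simp: mps_max_pow_eq_order_ge mps_order_ge_def)

lemma mps_max_pow_mult:
  "f \<in> mps_max_pow s \<Longrightarrow> g \<in> mps_max_pow t \<Longrightarrow> f * g \<in> mps_max_pow (s + t)"
  unfolding mps_max_pow_eq_order_ge by (rule mps_order_ge_mult)

lemma mps_max_pow_sum:
  "(\<And>i. i \<in> I \<Longrightarrow> F i \<in> mps_max_pow s) \<Longrightarrow> (\<Sum>i\<in>I. F i) \<in> mps_max_pow s"
  by (induction I rule: infinite_finite_induct) (auto intro: mps_max_pow_add)

lemma mps_max_pow_antimono: "s \<le> t \<Longrightarrow> f \<in> mps_max_pow t \<Longrightarrow> f \<in> mps_max_pow s"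
  by (auto simp: mps_max_pow_eq_order_ge mps_order_ge_def)

text \<open>Separatedness of the adic topology; it lets an identity of series be proved by
  successive approximation.\<close>

lemma mps_max_pow_Inter: "(\<And>s. f \<in> mps_max_pow s) \<Longrightarrow> f = 0"
  unfolding mps_max_pow_eq_order_ge mps_order_ge_def by (rule mps_eqI) auto

lemma mps_X_in_max_pow: "mps_X i \<in> mps_max_pow (Suc 0)"
  by (simp add: mps_max_pow_eq_order_ge mps_X_order)

lemma mps_max_pow_decompose:
  assumes "f \<in> mps_max_pow (Suc s)"
  obtains F where "\<And>i. F i \<in> mps_max_pow s" "f = (\<Sum>i\<in>UNIV. mps_X i * F i)"
  using assms mps_order_ge_decompose unfolding mps_max_pow_eq_order_ge by blast

lemma mps_const_split: "f - mps_const (mps_coeff f (\<lambda>_. 0)) \<in> mps_max_pow (Suc 0)"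
proof -
  have "sum m UNIV < Suc 0 \<longleftrightarrow> m = (\<lambda>_. 0)" for m :: "'a \<Rightarrow> nat"
    by (auto simp: fun_eq_iff)
  then show ?thesis
    by (simp add: mps_max_pow_eq_order_ge mps_order_ge_def mps_coeff_const)
qed


section \<open>Partial derivatives and the chain rule\<close>

lemma mps_pderiv_add: "mps_pderiv j (f + g) = mps_pderiv j f + mps_pderiv j g"
  for f g :: "('n::finite, 'k::comm_ring_1) mps"
  by (rule mps_eqI) (simp add: mps_coeff_pderiv distrib_left)

lemma mps_pderiv_const: "mps_pderiv j (mps_const c) = (0 :: ('n::finite, 'k::comm_ring_1) mps)"
proof (rule mps_eqI)
  fix m :: "'n \<Rightarrow> nat"
  have "m(j := m j + 1) \<noteq> (\<lambda>_. 0)"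
    by (metis add_is_0 fun_upd_same one_neq_zero)
  then show "mps_coeff (mps_pderiv j (mps_const c)) m = mps_coeff (0 :: ('n, 'k) mps) m"
    by (simp add: mps_coeff_pderiv mps_coeff_const)
qed

lemma mps_pderiv_X: "mps_pderiv j (mps_X i) = (if i = j then 1 else 0 :: ('n::finite, 'k::comm_ring_1) mps)"
proof (rule mps_eqI)
  fix m :: "'n \<Rightarrow> nat"
  have "m(j := m j + 1) = (\<lambda>l. if l = i then 1 else 0) \<longleftrightarrow> i = j \<and> m = (\<lambda>_. 0)"
    by (auto simp: fun_eq_iff split: if_splits)
  then show "mps_coeff (mps_pderiv j (mps_X i)) m = mps_coeff (if i = j then 1 else 0 :: ('n, 'k) mps) m"
    by (simp add: mps_coeff_pderiv mps_coeff_X)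
qed

text \<open>For every splitting (a, b) of m + e_j the factor m_j + 1 equals a_j + b_j. The part
  weighted by a_j is the coefficient of the first Leibniz term, the part weighted by b_j that of the
  second after swapping the factors.\<close>

lemma mps_pderiv_mult:
  fixes f g :: "('n::finite, 'k::comm_ring_1) mps"
  shows "mps_pderiv j (f * g) = mps_pderiv j f * g + f * mps_pderiv j g"
proof (rule mps_eqI)
  fix m :: "'n \<Rightarrow> nat"
  let ?m = "m(j := m j + 1)"
  have half: "(\<Sum>(a, b)\<in>exp_splits ?m. of_nat (a j) * mps_coeff f a * mps_coeff g b) =
      mps_coeff (mps_pderiv j f * g) m" for f g :: "('n, 'k) mps"
  proof -
    \<comment> \<open>Splittings with a_j = 0 have weight zero. Without them, lowering a_j by one is
      a bijection onto the splittings of m.\<close>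
    let ?S = "{p \<in> exp_splits ?m. fst p j \<noteq> 0}"
    have "(\<Sum>(a, b)\<in>exp_splits ?m. of_nat (a j) * mps_coeff f a * mps_coeff g b) =
        (\<Sum>(a, b)\<in>?S. of_nat (a j) * mps_coeff f a * mps_coeff g b)"
      by (rule sum.mono_neutral_right) (auto intro!: gr0I)
    also have "\<dots> = mps_coeff (mps_pderiv j f * g) m"
      unfolding mps_coeff_mult
      by (rule sum.reindex_bij_witness
          [where i = "\<lambda>(a, b). (a(j := a j + 1), b)" and j = "\<lambda>(a, b). (a(j := a j - 1), b)"])
        (auto simp: exp_splits_def mps_coeff_pderiv of_nat_diff split: if_splits)
    finally show ?thesis .
  qed
  have "mps_coeff (mps_pderiv j (f * g)) m =
      (\<Sum>(a, b)\<in>exp_splits ?m. of_nat (a j + b j) * (mps_coeff f a * mps_coeff g b))"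
    unfolding mps_coeff_pderiv mps_coeff_mult sum_distrib_left
    by (rule sum.cong) (auto simp: exp_splits_def simp del: of_nat_add of_nat_Suc dest!: spec[of _ j])
  also have "\<dots> = (\<Sum>(a, b)\<in>exp_splits ?m. of_nat (a j) * mps_coeff f a * mps_coeff g b) +
      (\<Sum>(a, b)\<in>exp_splits ?m. of_nat (b j) * mps_coeff g b * mps_coeff f a)"
    by (simp add: split_beta algebra_simps flip: sum.distrib)
  also have "(\<Sum>(a, b)\<in>exp_splits ?m. of_nat (b j) * mps_coeff g b * mps_coeff f a) =
      (\<Sum>(a, b)\<in>exp_splits ?m. of_nat (a j) * mps_coeff g a * mps_coeff f b)"
    by (rule sum.reindex_bij_witness[where i = prod.swap and j = prod.swap])
      (auto simp: exp_splits_def add.commute)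
  finally show "mps_coeff (mps_pderiv j (f * g)) m =
      mps_coeff (mps_pderiv j f * g + f * mps_pderiv j g) m"
    by (simp only: half mps_coeff_simps mult.commute[of "mps_pderiv j g" f])
qed

text \<open>The common core of elements of G, their composites and their inverses. Continuity is a
  consequence here, and \<open>X\<close> asks only that variables stay in m, which is enough both
  for preserving the powers of m and for the chain rule.\<close>

locale adic_endomorphism =
  fixes g :: "('n::finite, 'k::comm_ring_1) mps_map"
  assumes add: "g (f + h) = g f + g h"
    and mult: "g (f * h) = g f * g h"
    and const: "g (mps_const c) = mps_const c"
    and X: "g (mps_X i) \<in> mps_max_pow (Suc 0)"
begin

lemma zero [simp]: "g 0 = 0"
  using const[of 0] by (simp add: zero_mps_def)

lemma one [simp]: "g 1 = 1"
  using const[of 1] by (simp add: one_mps_def)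

lemma minus: "g (- f) = - g f"
  using add[of f "- f"] by (simp add: eq_neg_iff_add_eq_0 add.commute)

lemma diff: "g (f - h) = g f - g h"
  using add[of f "- h"] by (simp add: minus)

lemma sum: "g (\<Sum>i\<in>I. F i) = (\<Sum>i\<in>I. g (F i))"
  by (induction I rule: infinite_finite_induct) (auto simp: add)

lemma prod: "g (\<Prod>i\<in>I. F i) = (\<Prod>i\<in>I. g (F i))"
  by (induction I rule: infinite_finite_induct) (auto simp: mult)

lemma of_nat: "g (of_nat n) = of_nat n"
  by (induction n) (auto simp: add)

lemma of_int: "g (of_int n) = of_int n"
  by (cases n rule: int_cases2) (auto simp: minus of_nat)

lemma max_pow: "f \<in> mps_max_pow s \<Longrightarrow> g f \<in> mps_max_pow s"
proof (induction s arbitrary: f)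
  case (Suc s)
  then obtain F where "\<And>i. F i \<in> mps_max_pow s" "f = (\<Sum>i\<in>UNIV. mps_X i * F i)"
    using mps_max_pow_decompose by blast
  then show ?case
    using mps_max_pow_mult[OF X Suc.IH] by (auto simp: sum mult intro!: mps_max_pow_sum)
qed simp

text \<open>Since g preserves each power of m, \<open>t = s\<close> serves at every point.\<close>

lemma adic_continuous: "adic_continuous g"
  unfolding adic_continuous_def by (metis diff max_pow)

text \<open>The defect of the chain rule is a derivation along \<open>g\<close> killing constants and variables;
  it lies in every power of the maximal ideal.\<close>

lemma pderiv_chain:
  "mps_pderiv j (g f) = (\<Sum>l\<in>UNIV. g (mps_pderiv l f) * mps_pderiv j (g (mps_X l)))"
proof -
  define D where
    "D f = mps_pderiv j (g f) - (\<Sum>l\<in>UNIV. g (mps_pderiv l f) * mps_pderiv j (g (mps_X l)))" for f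
  have D_add: "D (f + h) = D f + D h" for f h
    by (simp add: D_def add mps_pderiv_add distrib_right sum.distrib)
  have D_mult: "D (f * h) = D f * g h + g f * D h" for f h
    by (simp add: D_def add mult mps_pderiv_add mps_pderiv_mult distrib_right sum.distrib
        sum_distrib_left algebra_simps)
  have D_const: "D (mps_const c) = 0" for c
    by (simp add: D_def const mps_pderiv_const)
  have D_X: "D (mps_X i) = 0" for i
    by (simp add: D_def mps_pderiv_X if_distrib[of g] if_distrib[of "\<lambda>x. x * _"] cong: if_cong)
  have D_sum: "D (\<Sum>i\<in>I. F i) = (\<Sum>i\<in>I. D (F i))" for I :: "'n set" and F
    using D_const[of 0] by (induction I rule: infinite_finite_induct) (auto simp: D_add zero_mps_def)
  have "D f \<in> mps_max_pow s" for s
  proof (induction s arbitrary: f)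
    case (Suc s)
    \<comment> \<open>Up to a constant, f is a sum of X_i F_i, so \<open>D f\<close> is the sum of
      g(X_i) \<open>D (F i)\<close>. The factor g(X_i) lies in m, hence each round gains one
      power.\<close>
    obtain F where F: "f - mps_const (mps_coeff f (\<lambda>_. 0)) = (\<Sum>i\<in>UNIV. mps_X i * F i)"
      using mps_max_pow_decompose[OF mps_const_split] by blast
    have "D f = D (mps_const (mps_coeff f (\<lambda>_. 0)) + (\<Sum>i\<in>UNIV. mps_X i * F i))"
      by (simp flip: F)
    also have "\<dots> = (\<Sum>i\<in>UNIV. g (mps_X i) * D (F i))"
      by (simp add: D_add D_const D_sum D_mult D_X)
    also have "\<dots> \<in> mps_max_pow (Suc s)"
      using mps_max_pow_mult[OF X Suc] by (auto intro: mps_max_pow_sum)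
    finally show ?case .
  qed simp
  then have "D f = 0"
    by (rule mps_max_pow_Inter)
  then show ?thesis
    by (simp add: D_def)
qed

text \<open>The chain rule for g applied to the series h(X_i) makes the Jacobian a matrix product in
  which g acts on the entries for h. A determinant is a polynomial in the entries with integer
  coefficients, so g passes through it.\<close>

lemma det_jacobian_comp: "det (jacobian (g \<circ> h)) = g (det (jacobian h)) * det (jacobian g)"
proof -
  have "jacobian (g \<circ> h) = (\<chi> i j. g (jacobian h $ i $ j)) ** jacobian g"
    by (simp add: jacobian_def matrix_matrix_mult_def vec_eq_iff pderiv_chain[of _ "h _"])
  moreover have "det (\<chi> i j. g (jacobian h $ i $ j)) = g (det (jacobian h))"
    by (simp add: det_def sum mult prod of_int)
  ultimately show ?thesis
    by (simp add: det_mul)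
qed

text \<open>The engine is g(XF) - XF = (gX - X) gF + X (gF - F). The bound has
  \<open>max 1 q\<close> because constants are fixed: removing the constant term puts f into m
  without changing gf - f.\<close>

lemma max_pow_diff:
  assumes "\<And>j. g (mps_X j) - mps_X j \<in> mps_max_pow (Suc a)" and "f \<in> mps_max_pow q"
  shows "g f - f \<in> mps_max_pow (max 1 q + a)"
proof -
  \<comment> \<open>Induction on q would be circular: q = 0 reduces to q = 1, which calls q = 0 for
    the cofactors \<open>F i\<close>. The auxiliary precision t breaks the circle, since the factor
    X_i improves it by one in each pass.\<close>
  have "g f - f \<in> mps_max_pow (min t (max 1 q + a))" if "f \<in> mps_max_pow q" for t q f
    using that
  proof (induction t arbitrary: q f)
    case (Suc t)
    have pos: "g f - f \<in> mps_max_pow (min (Suc t) (Suc r + a))" if f: "f \<in> mps_max_pow (Suc r)" for r f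
    proof -
      obtain F where F: "\<And>i. F i \<in> mps_max_pow r" "f = (\<Sum>i\<in>UNIV. mps_X i * F i)"
        using mps_max_pow_decompose[OF f] by blast
      have "g f - f = (\<Sum>i\<in>UNIV. (g (mps_X i) - mps_X i) * g (F i) + mps_X i * (g (F i) - F i))"
        by (simp add: F(2) sum mult left_diff_distrib right_diff_distrib sum.distrib sum_subtractf)
      moreover have "(g (mps_X i) - mps_X i) * g (F i) \<in> mps_max_pow (min (Suc t) (Suc r + a))" for i
        using mps_max_pow_mult[OF assms(1)[of i] max_pow[OF F(1)[of i]]]
        by (rule mps_max_pow_antimono[rotated]) auto
      moreover have "mps_X i * (g (F i) - F i) \<in> mps_max_pow (min (Suc t) (Suc r + a))" for i
        using mps_max_pow_mult[OF mps_X_in_max_pow[of i] Suc.IH[OF F(1)[of i]]]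
        by (rule mps_max_pow_antimono[rotated]) auto
      ultimately show ?thesis
        by (auto intro!: mps_max_pow_sum mps_max_pow_add)
    qed
    show ?case
    proof (cases q)
      case 0
      have "g f - f = g (f - mps_const (mps_coeff f (\<lambda>_. 0))) - (f - mps_const (mps_coeff f (\<lambda>_. 0)))"
        by (simp add: diff const)
      also have "\<dots> \<in> mps_max_pow (min (Suc t) (max 1 q + a))"
        using pos[OF mps_const_split, of f] 0 by simp
      finally show ?thesis .
    next
      case (Suc r)
      then show ?thesis
        using pos[of f r] Suc.prems by simp
    qed
  qed simp
  from this[OF assms(2), of "max 1 q + a"] show ?thesis
    by simp
qed

end


section \<open>The group of volume-preserving automorphisms\<close>

lemma vol_group_mult [simp]: "g \<otimes>\<^bsub>vol_group\<^esub> h = g \<circ> h"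
  and vol_group_one [simp]: "\<one>\<^bsub>vol_group\<^esub> = id"
  by (simp_all add: vol_group_def)

text \<open>From here on continuity disappears from view: it is discarded in one direction and
  recovered by \<open>adic_continuous\<close> in the other.\<close>

lemma vol_group_carrier_iff:
  "g \<in> carrier vol_group \<longleftrightarrow> adic_endomorphism g \<and> bij g \<and>
    (\<forall>j. g (mps_X j) - mps_X j \<in> mps_max_pow 2) \<and> det (jacobian g) = 1"
proof
  assume g: "g \<in> carrier vol_group"
  then have iso: "g \<in> ring_iso mps_ring mps_ring" and const: "\<And>c. g (mps_const c) = mps_const c"
    and X: "\<And>j. g (mps_X j) - mps_X j \<in> mps_max_pow 2" and det: "det (jacobian g) = 1"
    by (auto simp: vol_group_def continuous_automorphisms_def)
  have "adic_endomorphism g"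
  proof
    show "g (mps_X i) \<in> mps_max_pow (Suc 0)" for i
      using mps_max_pow_add[OF mps_max_pow_antimono[OF _ X[of i]] mps_X_in_max_pow[of i]] by simp
  qed (use ring_iso_memE(2,3)[OF iso] const in auto)
  moreover have "bij g"
    using ring_iso_memE(5)[OF iso] by simp
  ultimately show "adic_endomorphism g \<and> bij g \<and>
    (\<forall>j. g (mps_X j) - mps_X j \<in> mps_max_pow 2) \<and> det (jacobian g) = 1"
    using X det by blast
next
  assume g: "adic_endomorphism g \<and> bij g \<and>
    (\<forall>j. g (mps_X j) - mps_X j \<in> mps_max_pow 2) \<and> det (jacobian g) = 1"
  then interpret adic_endomorphism g
    by simp
  have "g \<in> ring_iso mps_ring mps_ring"
    using g by (intro ring_iso_memI) (auto simp: add mult)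
  then show "g \<in> carrier vol_group"
    using g const adic_continuous by (simp add: vol_group_def continuous_automorphisms_def)
qed

lemma vol_group_endomorphism: "g \<in> carrier vol_group \<Longrightarrow> adic_endomorphism g"
  by (simp add: vol_group_carrier_iff)

lemma vol_group_max_pow_diff:
  assumes "g \<in> carrier vol_group" "f \<in> mps_max_pow q"
  shows "g f - f \<in> mps_max_pow (Suc q)"
proof (rule mps_max_pow_antimono)
  show "g f - f \<in> mps_max_pow (max 1 q + 1)"
    using assms by (intro adic_endomorphism.max_pow_diff) (auto simp: vol_group_carrier_iff numeral_2_eq_2)
qed simp

text \<open>If f is in m^s then gf - f is already in m^(s+1), so gf in m^(s+1) forces f in m^(s+1).
  This is what makes the inverse map preserve the powers of m.\<close>

lemma vol_group_max_pow_iff: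
  assumes "g \<in> carrier vol_group"
  shows "g f \<in> mps_max_pow s \<longleftrightarrow> f \<in> mps_max_pow s"
proof
  assume "g f \<in> mps_max_pow s"
  then show "f \<in> mps_max_pow s"
  proof (induction s)
    case (Suc s)
    then have "f \<in> mps_max_pow s"
      using mps_max_pow_antimono[of s "Suc s" "g f"] by simp
    then have "g f - f \<in> mps_max_pow (Suc s)"
      by (rule vol_group_max_pow_diff[OF assms])
    then show ?case
      using mps_max_pow_diff[OF Suc.prems] by fastforce
  qed simp
qed (rule adic_endomorphism.max_pow[OF vol_group_endomorphism[OF assms]])

lemma vol_group_comp_closed:
  assumes "g \<in> carrier vol_group" "h \<in> carrier vol_group"
  shows "g \<circ> h \<in> carrier vol_group"
proof -
  interpret g: adic_endomorphism g
    using assms(1) by (rule vol_group_endomorphism)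
  interpret h: adic_endomorphism h
    using assms(2) by (rule vol_group_endomorphism)
  have "adic_endomorphism (g \<circ> h)"
    by unfold_locales (auto simp: g.add h.add g.mult h.mult g.const h.const intro: g.max_pow h.X)
  moreover have "(g \<circ> h) (mps_X j) - mps_X j \<in> mps_max_pow 2" for j
  proof -
    have "(g \<circ> h) (mps_X j) - mps_X j = g (h (mps_X j) - mps_X j) + (g (mps_X j) - mps_X j)"
      by (simp add: g.diff)
    also have "\<dots> \<in> mps_max_pow 2"
      using assms by (auto simp: vol_group_carrier_iff intro!: mps_max_pow_add g.max_pow)
    finally show ?thesis .
  qed
  moreover have "det (jacobian (g \<circ> h)) = 1"
    using assms by (simp add: g.det_jacobian_comp vol_group_carrier_iff)
  ultimately show ?thesis
    using assms by (simp add: vol_group_carrier_iff bij_comp)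
qed

lemma jacobian_id: "jacobian id = (mat 1 :: ('n::finite, 'k::comm_ring_1) mps ^ 'n ^ 'n)"
  by (simp add: jacobian_def mat_def mps_pderiv_X vec_eq_iff)

lemma vol_group_id_closed: "id \<in> carrier vol_group"
proof -
  have "adic_endomorphism (id :: ('a, 'b) mps_map)"
    by unfold_locales (auto intro: mps_X_in_max_pow)
  then show ?thesis
    by (simp add: vol_group_carrier_iff jacobian_id)
qed

text \<open>With h the inverse, hX - X = -h(gX - X) inherits the order condition because h preserves
  m^2. The chain rule for h after g gives h(1) det(jacobian h) = 1.\<close>

lemma vol_group_inverse_closed:
  assumes g: "g \<in> carrier vol_group"
  shows "inv_into UNIV g \<in> carrier vol_group"
proof -
  interpret g: adic_endomorphism g
    using g by (rule vol_group_endomorphism)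
  let ?h = "inv_into UNIV g"
  have bij: "bij g"
    using g by (simp add: vol_group_carrier_iff)
  then have gh: "g (?h f) = f" and hg: "?h (g f) = f" for f
    by (simp_all add: bij_is_surj surj_f_inv_f bij_is_inj)
  have h_max_pow: "?h f \<in> mps_max_pow s" if "f \<in> mps_max_pow s" for f s
    using vol_group_max_pow_iff[OF g, of "?h f" s] that by (simp add: gh)
  have h: "adic_endomorphism ?h"
  proof
    show "?h (f + f') = ?h f + ?h f'" for f f'
      by (metis g.add gh hg)
    show "?h (f * f') = ?h f * ?h f'" for f f'
      by (metis g.mult gh hg)
    show "?h (mps_const c) = mps_const c" for c
      by (metis g.const hg)
  qed (intro h_max_pow mps_X_in_max_pow)
  then interpret h: adic_endomorphism ?h .
  have "?h (mps_X j) - mps_X j \<in> mps_max_pow 2" for j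
  proof -
    have "?h (mps_X j) - mps_X j = - ?h (g (mps_X j) - mps_X j)"
      by (simp add: h.diff hg)
    also have "\<dots> \<in> mps_max_pow 2"
      using g by (auto simp: vol_group_carrier_iff intro!: mps_max_pow_minus h_max_pow)
    finally show ?thesis .
  qed
  moreover have "det (jacobian ?h) = 1"
  proof -
    have "?h \<circ> g = id"
      using hg by auto
    then have "?h (det (jacobian g)) * det (jacobian ?h) = 1"
      by (metis h.det_jacobian_comp jacobian_id det_I)
    then show ?thesis
      using g by (simp add: vol_group_carrier_iff)
  qed
  ultimately show ?thesis
    using h bij by (simp add: vol_group_carrier_iff bij_imp_bij_inv)
qed

lemma vol_group_inverse:
  assumes "g \<in> carrier vol_group"
  shows "g (inv_into UNIV g f) = f" "inv_into UNIV g (g f) = f"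
  using assms by (simp_all add: vol_group_carrier_iff bij_is_surj surj_f_inv_f bij_is_inj)

interpretation vol_group: group "vol_group :: ('n::finite, 'k::comm_ring_1) mps_map monoid"
proof (rule groupI)
  fix g :: "('n, 'k) mps_map"
  assume "g \<in> carrier vol_group"
  then show "\<exists>h\<in>carrier vol_group. h \<otimes>\<^bsub>vol_group\<^esub> g = \<one>\<^bsub>vol_group\<^esub>"
    by (intro bexI[of _ "inv_into UNIV g"]) (auto simp: vol_group_inverse vol_group_inverse_closed)
qed (auto simp: vol_group_comp_closed vol_group_id_closed comp_assoc)

lemma vol_group_m_inv:
  assumes "g \<in> carrier vol_group"
  shows "inv\<^bsub>vol_group\<^esub> g = inv_into UNIV g"
  using assms by (intro vol_group.inv_equality) (auto simp: vol_group_inverse vol_group_inverse_closed)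

text \<open>Constants are fixed, so \<open>max_pow_diff\<close> at q = 0 still yields exponent 1 + a
  for arbitrary f. Quantifying over all series instead of the variables allows substitution of any
  f, which makes closure under products, inverses and conjugation immediate.\<close>

lemma vol_subgroup_iff:
  "g \<in> vol_subgroup s \<longleftrightarrow> g \<in> carrier vol_group \<and> (\<forall>f. g f - f \<in> mps_max_pow s)"
proof (cases s)
  case 0
  then show ?thesis
    by (simp add: vol_subgroup_def)
next
  case (Suc a)
  have "g f - f \<in> mps_max_pow (Suc a)" if "g \<in> vol_subgroup s" for f
    using that adic_endomorphism.max_pow_diff[of g a f 0]
    by (auto simp: vol_subgroup_def Suc vol_group_endomorphism)
  then show ?thesis
    by (auto simp: vol_subgroup_def Suc)
qed

lemma vol_subgroup_max_pow_diff:
  assumes "g \<in> vol_subgroup (Suc a)" "f \<in> mps_max_pow q"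
  shows "g f - f \<in> mps_max_pow (q + a)"
proof (rule mps_max_pow_antimono)
  show "g f - f \<in> mps_max_pow (max 1 q + a)"
    using assms by (intro adic_endomorphism.max_pow_diff) (auto simp: vol_subgroup_def vol_group_endomorphism)
qed simp

lemma vol_subgroup_le_2: "s \<le> 2 \<Longrightarrow> vol_subgroup s = carrier vol_group"
  by (auto simp: vol_subgroup_def vol_group_carrier_iff intro: mps_max_pow_antimono)

lemma vol_subgroup_normal: "vol_subgroup s \<lhd> vol_group"
  unfolding vol_group.normal_inv_iff
proof (intro conjI ballI)
  show "subgroup (vol_subgroup s) (vol_group :: ('a, 'b) mps_map monoid)"
  proof (rule vol_group.subgroupI)
    show "vol_subgroup s \<subseteq> (carrier vol_group :: ('a, 'b) mps_map set)"
      by (auto simp: vol_subgroup_iff)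
    show "vol_subgroup s \<noteq> ({} :: ('a, 'b) mps_map set)"
      using vol_group_id_closed by (fastforce simp: vol_subgroup_iff)
    show "inv\<^bsub>vol_group\<^esub> g \<in> vol_subgroup s" if "g \<in> vol_subgroup s" for g :: "('a, 'b) mps_map"
    proof -
      have g: "g \<in> carrier vol_group"
        using that by (simp add: vol_subgroup_iff)
      have "inv_into UNIV g f - f \<in> mps_max_pow s" for f
      proof -
        have "g (inv_into UNIV g f) - inv_into UNIV g f \<in> mps_max_pow s"
          using that by (simp add: vol_subgroup_iff)
        from mps_max_pow_minus[OF this] show ?thesis
          by (simp add: vol_group_inverse[OF g])
      qed
      then show ?thesis
        using g by (simp add: vol_subgroup_iff vol_group_m_inv vol_group_inverse_closed)
    qed
    show "g \<otimes>\<^bsub>vol_group\<^esub> h \<in> vol_subgroup s"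
      if "g \<in> vol_subgroup s" "h \<in> vol_subgroup s" for g h :: "('a, 'b) mps_map"
    proof -
      have "g (h f) - f \<in> mps_max_pow s" for f
        using that mps_max_pow_add[of "g (h f) - h f" s "h f - f"] by (simp add: vol_subgroup_iff)
      then show ?thesis
        using that by (simp add: vol_subgroup_iff vol_group_comp_closed)
    qed
  qed
  fix h g :: "('a, 'b) mps_map"
  assume h: "h \<in> carrier vol_group" and g: "g \<in> vol_subgroup s"
  interpret h: adic_endomorphism h
    using h by (rule vol_group_endomorphism)
  have "h (g (inv_into UNIV h f)) - f \<in> mps_max_pow s" for f
  proof -
    have "h (g (inv_into UNIV h f)) - f = h (g (inv_into UNIV h f) - inv_into UNIV h f)"
      by (simp add: h.diff vol_group_inverse[OF h])
    then show ?thesis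
      using g by (simp add: vol_subgroup_iff h.max_pow)
  qed
  then show "h \<otimes>\<^bsub>vol_group\<^esub> g \<otimes>\<^bsub>vol_group\<^esub> inv\<^bsub>vol_group\<^esub> h \<in> vol_subgroup s"
    using g h by (simp add: vol_subgroup_iff vol_group_m_inv[OF h] vol_group_comp_closed
        vol_group_inverse_closed)
qed

text \<open>Substituting the g-preimage of f turns the condition on h g^-1 into a congruence between
  h and g. Thus two automorphisms define the same element of \<open>T_N\<close> exactly when they
  agree modulo m^N on all of \<open>A\<close>.\<close>

lemma vol_subgroup_coset:
  assumes g: "g \<in> carrier vol_group"
  shows "vol_subgroup N #>\<^bsub>vol_group\<^esub> g =
    {h \<in> carrier vol_group. \<forall>f. h f - g f \<in> mps_max_pow N}"
proof (intro equalityI subsetI)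
  fix h
  assume "h \<in> vol_subgroup N #>\<^bsub>vol_group\<^esub> g"
  then obtain u where "u \<in> vol_subgroup N" "h = u \<circ> g"
    by (auto simp: r_coset_def)
  then show "h \<in> {h \<in> carrier vol_group. \<forall>f. h f - g f \<in> mps_max_pow N}"
    using g by (simp add: vol_subgroup_iff vol_group_comp_closed)
next
  fix h
  assume h: "h \<in> {h \<in> carrier vol_group. \<forall>f. h f - g f \<in> mps_max_pow N}"
  have "h (inv_into UNIV g f) - f \<in> mps_max_pow N" for f
    using h vol_group_inverse(1)[OF g, of f] by (metis (mono_tags, lifting) mem_Collect_eq)
  then have "h \<circ> inv_into UNIV g \<in> vol_subgroup N"
    using h g by (simp add: vol_subgroup_iff vol_group_comp_closed vol_group_inverse_closed)
  moreover have "h = (h \<circ> inv_into UNIV g) \<circ> g"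
    by (simp add: fun_eq_iff vol_group_inverse[OF g])
  ultimately show "h \<in> vol_subgroup N #>\<^bsub>vol_group\<^esub> g"
    unfolding r_coset_def by auto
qed

lemma vol_subgroup_coset_self:
  "g \<in> carrier vol_group \<Longrightarrow> g \<in> vol_subgroup N #>\<^bsub>vol_group\<^esub> g"
  by (simp add: vol_subgroup_coset)

lemma vol_subgroup_coset_eqI:
  assumes "g \<in> carrier vol_group" "h \<in> carrier vol_group" "\<And>f. g f - h f \<in> mps_max_pow N"
  shows "vol_subgroup N #>\<^bsub>vol_group\<^esub> g = vol_subgroup N #>\<^bsub>vol_group\<^esub> h"
proof -
  have "h' f - g f \<in> mps_max_pow N \<longleftrightarrow> h' f - h f \<in> mps_max_pow N" for h' f
    using mps_max_pow_add[OF _ assms(3)[of f], of "h' f - g f"]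
      mps_max_pow_diff[OF _ assms(3)[of f], of "h' f - h f"] by auto
  then show ?thesis
    using assms(1,2) by (auto simp: vol_subgroup_coset)
qed


section \<open>The groups of jets\<close>

interpretation jet_group: group "jet_group N :: ('n::finite, 'k::comm_ring_1) mps_map set monoid"
  unfolding jet_group_def by (rule normal.factorgroup_is_group[OF vol_subgroup_normal])

lemma jet_group_one: "\<one>\<^bsub>jet_group N\<^esub> = vol_subgroup N"
  by (simp add: jet_group_def FactGroup_def)

lemma jet_group_carrier:
  "carrier (jet_group N) = (\<lambda>g. vol_subgroup N #>\<^bsub>vol_group\<^esub> g) ` carrier vol_group"
  by (auto simp: jet_group_def FactGroup_def RCOSETS_def)

lemma jet_group_mult:
  assumes "g \<in> carrier vol_group" "h \<in> carrier vol_group"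
  shows "(vol_subgroup N #>\<^bsub>vol_group\<^esub> g) \<otimes>\<^bsub>jet_group N\<^esub> (vol_subgroup N #>\<^bsub>vol_group\<^esub> h) =
    vol_subgroup N #>\<^bsub>vol_group\<^esub> (g \<circ> h)"
  using normal.rcos_sum[OF vol_subgroup_normal assms] by (simp add: jet_group_def FactGroup_def)

text \<open>An arbitrary representative. Only its values modulo m^N are determined by the coset, so
  the lemmas about it are congruences.\<close>

definition jet_lift :: "('n::finite, 'k::comm_ring_1) mps_map set \<Rightarrow> ('n, 'k) mps_map"
  where "jet_lift C = (SOME g. g \<in> C)"

lemma jet_lift_coset:
  assumes "g \<in> carrier vol_group"
  shows "jet_lift (vol_subgroup N #>\<^bsub>vol_group\<^esub> g) \<in> carrier vol_group"
    "jet_lift (vol_subgroup N #>\<^bsub>vol_group\<^esub> g) f - g f \<in> mps_max_pow N"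
  using someI[of "\<lambda>h. h \<in> vol_subgroup N #>\<^bsub>vol_group\<^esub> g", OF vol_subgroup_coset_self[OF assms]]
  by (simp_all add: jet_lift_def vol_subgroup_coset[OF assms])

lemma jet_lift_closed: "C \<in> carrier (jet_group N) \<Longrightarrow> jet_lift C \<in> carrier vol_group"
  by (auto simp: jet_group_carrier jet_lift_coset)

lemma jet_lift_coset_eq:
  assumes "C \<in> carrier (jet_group N)"
  shows "vol_subgroup N #>\<^bsub>vol_group\<^esub> jet_lift C = C"
proof -
  obtain g where "g \<in> carrier vol_group" "C = vol_subgroup N #>\<^bsub>vol_group\<^esub> g"
    using assms by (auto simp: jet_group_carrier)
  then show ?thesis
    using vol_subgroup_coset_eqI[OF jet_lift_coset(1) _ jet_lift_coset(2)] by simp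
qed

text \<open>The representative chosen for the unit coset need not be \<open>id\<close>; this
  congruence is the correction term wherever g - 1 is evaluated.\<close>

lemma jet_lift_one:
  fixes f :: "('n::finite, 'k::comm_ring_1) mps"
  shows "jet_lift \<one>\<^bsub>jet_group N\<^esub> f - f \<in> mps_max_pow N"
proof -
  have "\<one>\<^bsub>jet_group N\<^esub> = vol_subgroup N #>\<^bsub>vol_group\<^esub> (id :: ('n, 'k) mps_map)"
    by (auto simp: jet_group_one r_coset_def)
  then show ?thesis
    using jet_lift_coset(2)[OF vol_group_id_closed, of N f] by simp
qed

lemma jet_lift_mult:
  assumes C: "C \<in> carrier (jet_group N)" and D: "D \<in> carrier (jet_group N)"
  shows "jet_lift (C \<otimes>\<^bsub>jet_group N\<^esub> D) f - jet_lift C (jet_lift D f) \<in> mps_max_pow N"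
proof -
  have "C \<otimes>\<^bsub>jet_group N\<^esub> D = vol_subgroup N #>\<^bsub>vol_group\<^esub> (jet_lift C \<circ> jet_lift D)"
    using jet_group_mult[OF jet_lift_closed[OF C] jet_lift_closed[OF D], of N]
    by (simp add: jet_lift_coset_eq C D)
  then show ?thesis
    using jet_lift_coset(2)[OF vol_group_comp_closed[OF jet_lift_closed[OF C] jet_lift_closed[OF D]], of N f]
    by simp
qed

text \<open>Members of C agree modulo m^N', hence modulo the larger ideal m^N, so all of them have
  one and the same coset and \<open>the_elem\<close> is applied to a singleton.\<close>

lemma jet_quotient_eq:
  assumes "C \<in> carrier (jet_group N')" "N \<le> N'"
  shows "jet_quotient N C = vol_subgroup N #>\<^bsub>vol_group\<^esub> jet_lift C"
proof -
  have g: "jet_lift C \<in> carrier vol_group"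
    using assms(1) by (rule jet_lift_closed)
  have C: "C = {h \<in> carrier vol_group. \<forall>f. h f - jet_lift C f \<in> mps_max_pow N'}"
    using vol_subgroup_coset[OF g, of N'] jet_lift_coset_eq[OF assms(1)] by simp
  have "vol_subgroup N #>\<^bsub>vol_group\<^esub> h = vol_subgroup N #>\<^bsub>vol_group\<^esub> jet_lift C" if "h \<in> C" for h
    using that C g mps_max_pow_antimono[OF assms(2)] by (intro vol_subgroup_coset_eqI) blast+
  moreover have "jet_lift C \<in> C"
    using C g by auto
  ultimately have "(\<lambda>g. vol_subgroup N #>\<^bsub>vol_group\<^esub> g) ` C = {vol_subgroup N #>\<^bsub>vol_group\<^esub> jet_lift C}"
    by blast
  then show ?thesis
    by (simp add: jet_quotient_def)
qed


section \<open>Integral group rings and weighted filtrations\<close>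

lemma group_ring_simps [simp]:
  "z \<in> carrier (group_ring T) \<longleftrightarrow> Poly_Mapping.keys z \<subseteq> carrier T"
  "add (group_ring T) = (+)" "\<zero>\<^bsub>group_ring T\<^esub> = 0" "\<one>\<^bsub>group_ring T\<^esub> = frag_of \<one>\<^bsub>T\<^esub>"
  by (simp_all add: group_ring_def)

lemma group_ring_mult:
  "y \<otimes>\<^bsub>group_ring T\<^esub> z = frag_extend (\<lambda>g. frag_extend (\<lambda>h. frag_of (g \<otimes>\<^bsub>T\<^esub> h)) z) y"
  by (simp add: group_ring_def)

lemma group_ring_mult_of [simp]:
  "frag_of g \<otimes>\<^bsub>group_ring T\<^esub> frag_of h = frag_of (g \<otimes>\<^bsub>T\<^esub> h)"
  by (simp add: group_ring_mult)

lemma group_ring_zero_mult [simp]: "0 \<otimes>\<^bsub>group_ring T\<^esub> z = 0"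
  and group_ring_add_mult: "(x + y) \<otimes>\<^bsub>group_ring T\<^esub> z = x \<otimes>\<^bsub>group_ring T\<^esub> z + y \<otimes>\<^bsub>group_ring T\<^esub> z"
  and group_ring_diff_mult: "(x - y) \<otimes>\<^bsub>group_ring T\<^esub> z = x \<otimes>\<^bsub>group_ring T\<^esub> z - y \<otimes>\<^bsub>group_ring T\<^esub> z"
  by (simp_all add: group_ring_mult frag_extend_add frag_extend_diff)

lemma group_ring_mult_zero [simp]: "z \<otimes>\<^bsub>group_ring T\<^esub> 0 = 0"
  by (simp add: group_ring_mult frag_extend_eq_0)

lemma group_ring_mult_add: "z \<otimes>\<^bsub>group_ring T\<^esub> (x + y) = z \<otimes>\<^bsub>group_ring T\<^esub> x + z \<otimes>\<^bsub>group_ring T\<^esub> y"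
  by (simp add: group_ring_mult frag_extend_add)
    (simp add: frag_extend_def frag_cmul_distrib2 sum.distrib)

lemma group_ring_mult_diff: "z \<otimes>\<^bsub>group_ring T\<^esub> (x - y) = z \<otimes>\<^bsub>group_ring T\<^esub> x - z \<otimes>\<^bsub>group_ring T\<^esub> y"
  using group_ring_mult_add[where T = T and z = z and x = "x - y" and y = y] by (simp add: eq_diff_eq)

lemmas group_ring_distrib =
  group_ring_add_mult group_ring_diff_mult group_ring_mult_add group_ring_mult_diff

text \<open>Push-forward to the one-point set. As the value of an additive map the augmentation is
  visibly additive, without tracking how supports shrink under cancellation.\<close>

lemma augmentation_eq_lookup:
  "augmentation z = Poly_Mapping.lookup (frag_extend (\<lambda>_. frag_of ()) z) ()"
  by (simp add: augmentation_def frag_extend_def lookup_sum)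

lemma augmentation_simps [simp]:
  "augmentation 0 = 0" "augmentation (frag_of g) = 1"
  "augmentation (y + z) = augmentation y + augmentation z"
  "augmentation (y - z) = augmentation y - augmentation z"
  by (simp_all add: augmentation_eq_lookup frag_extend_add frag_extend_diff lookup_add lookup_minus)

lemma augmentation_extend_of: "augmentation (frag_extend (\<lambda>g. frag_of (f g)) z) = augmentation z"
  using frag_extend_compose[of "\<lambda>_. frag_of ()" f z]
  by (simp add: augmentation_eq_lookup comp_def)

lemma augmentation_mult: "augmentation (y \<otimes>\<^bsub>group_ring T\<^esub> z) = augmentation y * augmentation z"
  using subset_UNIV[of "Poly_Mapping.keys y"]
proof (induction y rule: frag_induction)
  case (one g)
  then show ?case
    by (simp add: group_ring_mult augmentation_extend_of)
qed (simp_all add: group_ring_diff_mult left_diff_distrib)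

definition weighted_product :: "('g, 'm) monoid_scheme \<Rightarrow> (nat \<times> 'g) list \<Rightarrow> ('g \<Rightarrow>\<^sub>0 int)"
  where "weighted_product T bhs =
    foldr (\<otimes>\<^bsub>group_ring T\<^esub>) (map (\<lambda>(b, h). group_ring_diff T h) bhs) \<one>\<^bsub>group_ring T\<^esub>"

definition weighted_list :: "(nat \<Rightarrow> 'g set) \<Rightarrow> nat \<Rightarrow> (nat \<times> 'g) list \<Rightarrow> bool"
  where "weighted_list H a bhs \<longleftrightarrow>
    bhs \<noteq> [] \<and> (\<forall>(b, h)\<in>set bhs. b \<ge> 1 \<and> h \<in> H b) \<and> sum_list (map fst bhs) \<ge> a"

lemma weighted_ideal_eq:
  "weighted_ideal T H a =
    generate (add_monoid (group_ring T)) {weighted_product T bhs | bhs. weighted_list H a bhs}"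
  by (simp add: weighted_ideal_def weighted_product_def weighted_list_def)

section \<open>The integral group ring as a ring, and criteria for its ideals\<close>

context group
begin

lemma group_ring_mult_keys:
  assumes "Poly_Mapping.keys y \<subseteq> carrier G" "Poly_Mapping.keys z \<subseteq> carrier G"
  shows "Poly_Mapping.keys (y \<otimes>\<^bsub>group_ring G\<^esub> z) \<subseteq> carrier G"
  using assms unfolding group_ring_mult
  by (fastforce dest!: subsetD[OF keys_frag_extend] split: if_splits)

lemma group_ring_mult_assoc:
  assumes "Poly_Mapping.keys x \<subseteq> carrier G" "Poly_Mapping.keys y \<subseteq> carrier G"
    "Poly_Mapping.keys z \<subseteq> carrier G"
  shows "x \<otimes>\<^bsub>group_ring G\<^esub> y \<otimes>\<^bsub>group_ring G\<^esub> z = x \<otimes>\<^bsub>group_ring G\<^esub> (y \<otimes>\<^bsub>group_ring G\<^esub> z)"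
  using assms(1)
proof (induction x rule: frag_induction)
  case (one g)
  show ?case
    using assms(2)
  proof (induction y rule: frag_induction)
    case (one h)
    show ?case
      using assms(3)
    proof (induction z rule: frag_induction)
      case (one l)
      then show ?case
        using \<open>g \<in> carrier G\<close> \<open>h \<in> carrier G\<close> by (simp add: m_assoc)
    qed (simp_all add: group_ring_distrib)
  qed (simp_all add: group_ring_distrib)
qed (simp_all add: group_ring_distrib)

lemma group_ring_one_mult:
  assumes "Poly_Mapping.keys z \<subseteq> carrier G"
  shows "frag_of \<one> \<otimes>\<^bsub>group_ring G\<^esub> z = z" "z \<otimes>\<^bsub>group_ring G\<^esub> frag_of \<one> = z"
  using assms by (induction z rule: frag_induction) (simp_all add: group_ring_distrib)

lemma group_ring_is_ring: "ring (group_ring G)"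
proof (rule ringI)
  show "abelian_group (group_ring G)"
  proof (rule abelian_groupI)
    fix x
    assume "x \<in> carrier (group_ring G)"
    then show "\<exists>y\<in>carrier (group_ring G). y \<oplus>\<^bsub>group_ring G\<^esub> x = \<zero>\<^bsub>group_ring G\<^esub>"
      by (intro bexI[of _ "- x"]) auto
  qed (auto simp: add_ac dest!: subsetD[OF Poly_Mapping.keys_add])
  show "monoid (group_ring G)"
    by (rule monoidI) (simp_all add: group_ring_mult_keys group_ring_mult_assoc group_ring_one_mult)
qed (simp_all add: group_ring_distrib)

lemma group_ring_a_inv: "Poly_Mapping.keys x \<subseteq> carrier G \<Longrightarrow> \<ominus>\<^bsub>group_ring G\<^esub> x = - x"
  by (rule abelian_group.minus_equality[OF ring.is_abelian_group[OF group_ring_is_ring]]) auto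

lemma group_ring_diff_eq: "group_ring_diff G g = frag_of g - frag_of \<one>"
  by (simp add: group_ring_diff_def a_minus_def group_ring_a_inv)

lemma group_ring_diff_keys: "g \<in> carrier G \<Longrightarrow> Poly_Mapping.keys (group_ring_diff G g) \<subseteq> carrier G"
  using keys_diff[of "frag_of g" "frag_of \<one>"] by (auto simp: group_ring_diff_eq)

text \<open>Closure is phrased by zero and differences because \<open>frag_induction\<close> builds
  an element from zero, basis elements and differences; the same facts then discharge both kinds of
  goal.\<close>

lemma group_ring_subgroupI:
  assumes "\<And>x. x \<in> J \<Longrightarrow> Poly_Mapping.keys x \<subseteq> carrier G" "0 \<in> J"
    and "\<And>x y. x \<in> J \<Longrightarrow> y \<in> J \<Longrightarrow> x - y \<in> J"
  shows "subgroup J (add_monoid (group_ring G))"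
proof (rule group.subgroupI)
  show "group (add_monoid (group_ring G))"
    by (rule abelian_group.a_group[OF ring.is_abelian_group[OF group_ring_is_ring]])
  have minus: "- x \<in> J" if "x \<in> J" for x
    using assms(3)[OF assms(2) that] by simp
  show "inv\<^bsub>add_monoid (group_ring G)\<^esub> x \<in> J" if "x \<in> J" for x
    using group_ring_a_inv[OF assms(1)[OF that]] minus[OF that] by (simp add: a_inv_def)
  show "x \<otimes>\<^bsub>add_monoid (group_ring G)\<^esub> y \<in> J" if "x \<in> J" "y \<in> J" for x y
    using assms(3)[OF that(1) minus[OF that(2)]] by simp
qed (use assms in auto)

lemma group_ring_idealI:
  assumes "\<And>x. x \<in> J \<Longrightarrow> Poly_Mapping.keys x \<subseteq> carrier G" "0 \<in> J"
    and "\<And>x y. x \<in> J \<Longrightarrow> y \<in> J \<Longrightarrow> x - y \<in> J"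
    and "\<And>x y. x \<in> J \<Longrightarrow> Poly_Mapping.keys y \<subseteq> carrier G \<Longrightarrow> y \<otimes>\<^bsub>group_ring G\<^esub> x \<in> J"
    and "\<And>x y. x \<in> J \<Longrightarrow> Poly_Mapping.keys y \<subseteq> carrier G \<Longrightarrow> x \<otimes>\<^bsub>group_ring G\<^esub> y \<in> J"
  shows "ideal J (group_ring G)"
proof (rule idealI)
  show "subgroup J (add_monoid (group_ring G))"
    using assms(1-3) by (rule group_ring_subgroupI)
qed (use assms(4,5) in \<open>auto intro: group_ring_is_ring\<close>)

lemma group_ring_ideal_prod_subset:
  assumes "\<And>x y. x \<in> I \<Longrightarrow> y \<in> J \<Longrightarrow> x \<otimes>\<^bsub>group_ring G\<^esub> y \<in> K"
    and "\<And>x y. x \<in> K \<Longrightarrow> y \<in> K \<Longrightarrow> x - y \<in> K" and "0 \<in> K"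
  shows "I \<cdot>\<^bsub>group_ring G\<^esub> J \<subseteq> K"
proof
  fix x
  assume "x \<in> I \<cdot>\<^bsub>group_ring G\<^esub> J"
  then show "x \<in> K"
  proof induction
    case (sum x y)
    then show ?case
      using assms(2)[OF sum.IH(1) assms(2)[OF assms(3) sum.IH(2)]] by simp
  qed (rule assms(1))
qed

end

text \<open>The formal half of the theorem, free of power series. \<open>weight_one\<close> gives
  every g - 1 weight one, which makes the first group the augmentation ideal and all of them
  two-sided ideals.\<close>

locale weighted_group = group G for G (structure) +
  fixes H :: "nat \<Rightarrow> 'a set"
  assumes weight_closed: "H b \<subseteq> carrier G" and weight_one: "H 1 = carrier G"
begin

lemma weighted_product_Nil: "weighted_product G [] = frag_of \<one>"
  and weighted_product_Cons:
    "weighted_product G ((b, h) # bhs) = group_ring_diff G h \<otimes>\<^bsub>group_ring G\<^esub> weighted_product G bhs"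
  by (simp_all add: weighted_product_def)

lemma weighted_product_keys:
  assumes "snd ` set bhs \<subseteq> carrier G"
  shows "Poly_Mapping.keys (weighted_product G bhs) \<subseteq> carrier G"
  using assms
proof (induction bhs)
  case (Cons bh bhs)
  then show ?case
    by (cases bh) (simp add: weighted_product_Cons group_ring_mult_keys group_ring_diff_keys)
qed (simp add: weighted_product_Nil)

lemma weighted_product_append:
  assumes "snd ` set bhs \<subseteq> carrier G" "snd ` set bhs' \<subseteq> carrier G"
  shows "weighted_product G (bhs @ bhs') =
    weighted_product G bhs \<otimes>\<^bsub>group_ring G\<^esub> weighted_product G bhs'"
  using assms
  by (induction bhs)
    (auto simp: weighted_product_Nil weighted_product_Cons group_ring_one_mult weighted_product_keys
      group_ring_diff_keys group_ring_mult_assoc)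

lemma weighted_list_carrier: "weighted_list H a bhs \<Longrightarrow> snd ` set bhs \<subseteq> carrier G"
  using weight_closed by (fastforce simp: weighted_list_def)

lemma weighted_ideal_subgroup: "subgroup (weighted_ideal G H a) (add_monoid (group_ring G))"
  unfolding weighted_ideal_eq
  by (intro group.generate_is_subgroup abelian_group.a_group ring.is_abelian_group group_ring_is_ring)
    (use weighted_product_keys weighted_list_carrier in fastforce)

lemma weighted_ideal_keys: "x \<in> weighted_ideal G H a \<Longrightarrow> Poly_Mapping.keys x \<subseteq> carrier G"
  using subgroup.mem_carrier[OF weighted_ideal_subgroup] by fastforce

lemma weighted_ideal_zero: "0 \<in> weighted_ideal G H a"
  using subgroup.one_closed[OF weighted_ideal_subgroup] by simp

lemma weighted_ideal_diff:
  assumes "x \<in> weighted_ideal G H a" "y \<in> weighted_ideal G H a"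
  shows "x - y \<in> weighted_ideal G H a"
proof -
  have "- y \<in> weighted_ideal G H a"
    using subgroup.m_inv_closed[OF weighted_ideal_subgroup assms(2)]
      group_ring_a_inv[OF weighted_ideal_keys[OF assms(2)]] by (simp add: a_inv_def)
  then show ?thesis
    using subgroup.m_closed[OF weighted_ideal_subgroup assms(1)] by fastforce
qed

lemma weighted_ideal_add:
  assumes "x \<in> weighted_ideal G H a" "y \<in> weighted_ideal G H a"
  shows "x + y \<in> weighted_ideal G H a"
  using weighted_ideal_diff[OF assms(1) weighted_ideal_diff[OF weighted_ideal_zero assms(2)]] by simp

lemma weighted_ideal_product: "weighted_list H a bhs \<Longrightarrow> weighted_product G bhs \<in> weighted_ideal G H a"
  unfolding weighted_ideal_eq by (rule generate.incl) auto

lemma weighted_ideal_diff_of: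
  assumes "1 \<le> a" "h \<in> H a"
  shows "group_ring_diff G h \<in> weighted_ideal G H a"
proof -
  have "h \<in> carrier G"
    using assms(2) weight_closed by blast
  then show ?thesis
    using weighted_ideal_product[of a "[(a, h)]"] assms
    by (simp add: weighted_list_def weighted_product_Nil weighted_product_Cons group_ring_one_mult
        group_ring_diff_keys)
qed

text \<open>The members satisfying P form an additive subgroup that contains all generators, hence
  everything.\<close>

lemma weighted_ideal_induct [consumes 1, case_names zero product diff]:
  assumes "x \<in> weighted_ideal G H a" "P 0"
    and "\<And>bhs. weighted_list H a bhs \<Longrightarrow> P (weighted_product G bhs)"
    and "\<And>x y. x \<in> weighted_ideal G H a \<Longrightarrow> y \<in> weighted_ideal G H a \<Longrightarrow> P x \<Longrightarrow> P y \<Longrightarrow> P (x - y)"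
  shows "P x"
proof -
  let ?J = "{x \<in> weighted_ideal G H a. P x}"
  have "subgroup ?J (add_monoid (group_ring G))"
    using assms by (intro group_ring_subgroupI)
      (auto intro: weighted_ideal_zero weighted_ideal_diff dest: weighted_ideal_keys)
  moreover have "{weighted_product G bhs |bhs. weighted_list H a bhs} \<subseteq> ?J"
    using assms(3) weighted_ideal_product by blast
  ultimately have "generate (add_monoid (group_ring G))
      {weighted_product G bhs |bhs. weighted_list H a bhs} \<subseteq> ?J"
    by (intro group.generate_subgroup_incl abelian_group.a_group ring.is_abelian_group
        group_ring_is_ring)
  then have "x \<in> ?J"
    using assms(1) weighted_ideal_eq[of G H a] by (metis (no_types, lifting) subsetD)
  then show ?thesis
    by simp
qed

text \<open>Biadditivity reduces to generators, where concatenating the two lists multiplies the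
  products and adds the weights.\<close>

lemma weighted_ideal_mult:
  assumes "x \<in> weighted_ideal G H a" "y \<in> weighted_ideal G H b"
  shows "x \<otimes>\<^bsub>group_ring G\<^esub> y \<in> weighted_ideal G H (a + b)"
  using assms(1)
proof (induction rule: weighted_ideal_induct)
  case (product bhs)
  show ?case
    using assms(2)
  proof (induction rule: weighted_ideal_induct)
    case (product bhs')
    have "weighted_list H (a + b) (bhs @ bhs')"
      using \<open>weighted_list H a bhs\<close> product by (auto simp: weighted_list_def)
    from weighted_ideal_product[OF this] show ?case
      by (simp add: weighted_product_append weighted_list_carrier[OF product]
          weighted_list_carrier[OF \<open>weighted_list H a bhs\<close>])
  qed (simp_all add: weighted_ideal_zero weighted_ideal_diff group_ring_distrib)
qed (simp_all add: weighted_ideal_zero weighted_ideal_diff group_ring_distrib)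

lemma weighted_ideal_antimono: "a \<le> b \<Longrightarrow> weighted_ideal G H b \<subseteq> weighted_ideal G H a"
proof
  fix x
  assume "a \<le> b" "x \<in> weighted_ideal G H b"
  from this(2) show "x \<in> weighted_ideal G H a"
  proof (induction rule: weighted_ideal_induct)
    case (product bhs)
    then show ?case
      using \<open>a \<le> b\<close> by (auto intro!: weighted_ideal_product simp: weighted_list_def)
  qed (simp_all add: weighted_ideal_zero weighted_ideal_diff)
qed

text \<open>Write g = (g - 1) + 1: multiplying by g - 1 moves x into index a + 1, which is contained
  in index a, and multiplying by 1 leaves x alone.\<close>

lemma weighted_ideal_ideal: "ideal (weighted_ideal G H a) (group_ring G)"
proof (rule group_ring_idealI)
  fix x y :: "'a \<Rightarrow>\<^sub>0 int"
  assume x: "x \<in> weighted_ideal G H a" and y: "Poly_Mapping.keys y \<subseteq> carrier G"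
  have diff: "group_ring_diff G g \<in> weighted_ideal G H 1" if "g \<in> carrier G" for g
    using that by (intro weighted_ideal_diff_of) (simp_all only: weight_one order_refl)
  have of: "frag_of g = group_ring_diff G g + frag_of \<one>" for g
    by (simp add: group_ring_diff_eq)
  show "y \<otimes>\<^bsub>group_ring G\<^esub> x \<in> weighted_ideal G H a"
    using y
  proof (induction y rule: frag_induction)
    case (one g)
    have "group_ring_diff G g \<otimes>\<^bsub>group_ring G\<^esub> x + x \<in> weighted_ideal G H a"
      using weighted_ideal_mult[OF diff[OF one] x] x weighted_ideal_antimono[of a "1 + a"]
      by (auto intro: weighted_ideal_add)
    then show ?case
      by (subst of) (simp add: group_ring_distrib group_ring_one_mult weighted_ideal_keys[OF x])
  qed (simp_all add: weighted_ideal_zero weighted_ideal_diff group_ring_distrib)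
  show "x \<otimes>\<^bsub>group_ring G\<^esub> y \<in> weighted_ideal G H a"
    using y
  proof (induction y rule: frag_induction)
    case (one g)
    have "x \<otimes>\<^bsub>group_ring G\<^esub> group_ring_diff G g + x \<in> weighted_ideal G H a"
      using weighted_ideal_mult[OF x diff[OF one]] x weighted_ideal_antimono[of a "a + 1"]
      by (auto intro: weighted_ideal_add)
    then show ?case
      by (subst of) (simp add: group_ring_distrib group_ring_one_mult weighted_ideal_keys[OF x])
  qed (simp_all add: weighted_ideal_zero weighted_ideal_diff group_ring_distrib)
qed (use weighted_ideal_keys weighted_ideal_zero weighted_ideal_diff in auto)

lemma weighted_ideal_one: "weighted_ideal G H 1 = aug_ideal G"
proof (intro equalityI subsetI)
  fix x
  assume "x \<in> weighted_ideal G H 1"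
  then have "augmentation x = 0"
  proof (induction rule: weighted_ideal_induct)
    case (product bhs)
    then obtain b h bhs' where "bhs = (b, h) # bhs'"
      by (cases bhs) (auto simp: weighted_list_def)
    then show ?case
      by (simp add: weighted_product_Cons augmentation_mult group_ring_diff_eq)
  qed simp_all
  then show "x \<in> aug_ideal G"
    using weighted_ideal_keys[OF \<open>x \<in> weighted_ideal G H 1\<close>] by (simp add: aug_ideal_def)
next
  fix x
  assume "x \<in> aug_ideal G"
  then have x: "Poly_Mapping.keys x \<subseteq> carrier G" "augmentation x = 0"
    by (simp_all add: aug_ideal_def)
  \<comment> \<open>Basis elements have augmentation 1, so the vanishing hypothesis does not survive
    induction. Subtracting the augmentation times the unit gives a claim valid for every
    element.\<close>
  from x(1) have "x - frag_cmul (augmentation x) (frag_of \<one>) \<in> weighted_ideal G H 1"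
  proof (induction x rule: frag_induction)
    case (one g)
    then show ?case
      using weighted_ideal_diff_of[of 1 g] weight_one by (simp add: group_ring_diff_eq)
  next
    case (diff x y)
    then show ?case
      using weighted_ideal_diff[OF diff] by (simp add: frag_cmul_diff_distrib algebra_simps)
  qed (simp add: weighted_ideal_zero)
  then show "x \<in> weighted_ideal G H 1"
    using x(2) by simp
qed

end


section \<open>The action on jets\<close>

lemma mps_ring_coset: "mps_max_pow N +>\<^bsub>mps_ring\<^esub> f = {h. h - f \<in> mps_max_pow N}"
  unfolding a_r_coset_def' by (auto intro!: exI[of _ "_ - f"])

lemma mps_ring_coset_eq_iff:
  "mps_max_pow N +>\<^bsub>mps_ring\<^esub> f = mps_max_pow N +>\<^bsub>mps_ring\<^esub> g \<longleftrightarrow> f - g \<in> mps_max_pow N"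
proof
  assume eq: "mps_max_pow N +>\<^bsub>mps_ring\<^esub> f = mps_max_pow N +>\<^bsub>mps_ring\<^esub> g"
  have "f \<in> mps_max_pow N +>\<^bsub>mps_ring\<^esub> f"
    by (simp add: mps_ring_coset)
  then show "f - g \<in> mps_max_pow N"
    unfolding eq by (simp add: mps_ring_coset)
next
  assume fg: "f - g \<in> mps_max_pow N"
  have "h - f \<in> mps_max_pow N \<longleftrightarrow> h - g \<in> mps_max_pow N" for h
    using mps_max_pow_add[OF _ fg, of "h - f"] mps_max_pow_diff[OF _ fg, of "h - g"] by auto
  then show "mps_max_pow N +>\<^bsub>mps_ring\<^esub> f = mps_max_pow N +>\<^bsub>mps_ring\<^esub> g"
    by (simp add: mps_ring_coset)
qed

lemma mps_ring_a_inv: "\<ominus>\<^bsub>mps_ring\<^esub> f = - f"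
  by (rule abelian_group.minus_equality[OF ring.is_abelian_group[OF ring_from_type_algebra]]) auto

lemma mps_ring_finsum: "finsum mps_ring F I = (\<Sum>i\<in>I. F i)"
  for F :: "'i \<Rightarrow> ('n::finite, 'k::comm_ring_1) mps"
proof -
  interpret ring "mps_ring :: ('n, 'k) mps ring"
    by (rule ring_from_type_algebra)
  show ?thesis
    by (induction I rule: infinite_finite_induct) (simp_all add: finsum_infinite)
qed

lemma mps_ring_add_pow: "[k] \<cdot>\<^bsub>mps_ring\<^esub> f = of_int k * f" for k :: int
proof -
  have nat: "Group.pow (add_monoid mps_ring) f n = of_nat n * f" for n :: nat
    by (induction n) (auto simp: nat_pow_def algebra_simps)
  have minus: "inv\<^bsub>add_monoid mps_ring\<^esub> g = - g" for g :: "('a, 'b) mps"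
    using mps_ring_a_inv[of g] unfolding a_inv_def .
  show ?thesis
    unfolding add_pow_def int_pow_def2 nat minus by auto
qed

text \<open>Reduction modulo m^N is a ring homomorphism, so it commutes with finite sums and integer
  multiples; this lets \<open>jet_rep\<close> be computed in \<open>A\<close>.\<close>

lemma jet_ring_combination:
  "(\<Oplus>\<^bsub>jet_ring N\<^esub>i\<in>I. [k i] \<cdot>\<^bsub>jet_ring N\<^esub> (mps_max_pow N +>\<^bsub>mps_ring\<^esub> F i)) =
    mps_max_pow N +>\<^bsub>mps_ring\<^esub> (\<Sum>i\<in>I. of_int (k i) * F i)" for k :: "'i \<Rightarrow> int"
proof -
  interpret I: ideal "mps_max_pow N" mps_ring
    by (rule ideal_mps_max_pow)
  interpret h: ring_hom_ring mps_ring "jet_ring N" "(+>\<^bsub>mps_ring\<^esub>) (mps_max_pow N)"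
    unfolding jet_ring_def by (rule I.rcos_ring_hom_ring)
  have "mps_max_pow N +>\<^bsub>mps_ring\<^esub> (of_int (k i) * F i) =
      [k i] \<cdot>\<^bsub>jet_ring N\<^esub> (mps_max_pow N +>\<^bsub>mps_ring\<^esub> F i)" for i
    using group_hom.hom_int_pow[OF h.a_group_hom, of "F i" "k i"]
    by (simp add: add_pow_def flip: mps_ring_add_pow)
  then show ?thesis
    using h.hom_finsum[of "\<lambda>i. of_int (k i) * F i" I] by (simp add: mps_ring_finsum comp_def)
qed

text \<open>The powers of m form a chain, so m^q + m^N is the larger of the two. All later
  occurrences of \<open>min\<close> go back to this.\<close>

lemma jet_filtration_eq:
  "jet_filtration N q = (\<lambda>f. mps_max_pow N +>\<^bsub>mps_ring\<^esub> f) ` mps_max_pow (min q N)"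
proof -
  have "mps_max_pow q <+>\<^bsub>mps_ring\<^esub> mps_max_pow N = (mps_max_pow (min q N) :: ('a, 'b) mps set)"
  proof (intro equalityI subsetI)
    fix f :: "('a, 'b) mps"
    assume "f \<in> mps_max_pow q <+>\<^bsub>mps_ring\<^esub> mps_max_pow N"
    then show "f \<in> mps_max_pow (min q N)"
      unfolding set_add_def' by (auto intro!: mps_max_pow_add elim: mps_max_pow_antimono[rotated])
  next
    fix f :: "('a, 'b) mps"
    assume "f \<in> mps_max_pow (min q N)"
    then have "\<exists>g\<in>mps_max_pow q. \<exists>h\<in>mps_max_pow N. f = g + h"
      using mps_max_pow_zero[of q] mps_max_pow_zero[of N]
      by (metis add.left_neutral add.right_neutral min_def)
    then show "f \<in> mps_max_pow q <+>\<^bsub>mps_ring\<^esub> mps_max_pow N"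
      unfolding set_add_def' by auto
  qed
  then show ?thesis
    by (simp add: jet_filtration_def)
qed

lemma jet_filtration_coset_iff:
  "mps_max_pow N +>\<^bsub>mps_ring\<^esub> f \<in> jet_filtration N q \<longleftrightarrow> f \<in> mps_max_pow (min q N)"
proof
  assume "mps_max_pow N +>\<^bsub>mps_ring\<^esub> f \<in> jet_filtration N q"
  then obtain g where g: "g \<in> mps_max_pow (min q N)" "f - g \<in> mps_max_pow N"
    by (auto simp: jet_filtration_eq mps_ring_coset_eq_iff)
  then have "f - g \<in> mps_max_pow (min q N)"
    using mps_max_pow_antimono[of "min q N" N "f - g"] by simp
  then show "f \<in> mps_max_pow (min q N)"
    using mps_max_pow_add[OF _ g(1)] by fastforce
qed (simp add: jet_filtration_eq)

text \<open>Changing the representative of C alters the image by an element of m^N, and changing f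
  within its class alters it by the image of an element of m^N, again in m^N. The set under
  \<open>the_elem\<close> is therefore a singleton.\<close>

lemma jet_action_coset:
  assumes C: "C \<in> carrier (jet_group N)"
  shows "jet_action N C (mps_max_pow N +>\<^bsub>mps_ring\<^esub> f) = mps_max_pow N +>\<^bsub>mps_ring\<^esub> jet_lift C f"
proof -
  have g: "jet_lift C \<in> carrier vol_group"
    using C by (rule jet_lift_closed)
  have C_eq: "C = {h \<in> carrier vol_group. \<forall>f. h f - jet_lift C f \<in> mps_max_pow N}"
    using vol_subgroup_coset[OF g, of N] jet_lift_coset_eq[OF C] by simp
  have "mps_max_pow N +>\<^bsub>mps_ring\<^esub> h f' = mps_max_pow N +>\<^bsub>mps_ring\<^esub> jet_lift C f"
    if "h \<in> C" "f' - f \<in> mps_max_pow N" for h f'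
  proof -
    have h: "h \<in> carrier vol_group" "h f - jet_lift C f \<in> mps_max_pow N"
      using that(1) C_eq by blast+
    interpret h: adic_endomorphism h
      using h(1) by (rule vol_group_endomorphism)
    show ?thesis
      using mps_max_pow_add[OF h.max_pow[OF that(2)] h(2)]
      by (simp add: mps_ring_coset_eq_iff h.diff)
  qed
  moreover have "jet_lift C \<in> C" "f \<in> mps_max_pow N +>\<^bsub>mps_ring\<^esub> f"
    using C_eq g by (auto simp: mps_ring_coset)
  ultimately have "{mps_max_pow N +>\<^bsub>mps_ring\<^esub> h f' | h f'. h \<in> C \<and> f' \<in> mps_max_pow N +>\<^bsub>mps_ring\<^esub> f} =
      {mps_max_pow N +>\<^bsub>mps_ring\<^esub> jet_lift C f}"
    unfolding mps_ring_coset[of N f] by blast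
  then show ?thesis
    by (simp add: jet_action_def)
qed

text \<open>A lift of \<open>jet_rep\<close> from \<open>A/\<mm>\<^sup>N\<close> to \<open>A\<close>; it is a ring homomorphism only modulo \<open>\<mm>\<^sup>N\<close>.\<close>

definition jet_op ::
    "(('n::finite, 'k::comm_ring_1) mps_map set \<Rightarrow>\<^sub>0 int) \<Rightarrow> ('n, 'k) mps \<Rightarrow> ('n, 'k) mps"
  where "jet_op z f =
    (\<Sum>C\<in>Poly_Mapping.keys z. of_int (Poly_Mapping.lookup z C) * jet_lift C f)"

lemma jet_rep_coset:
  assumes "Poly_Mapping.keys z \<subseteq> carrier (jet_group N)"
  shows "jet_rep N z (mps_max_pow N +>\<^bsub>mps_ring\<^esub> f) = mps_max_pow N +>\<^bsub>mps_ring\<^esub> jet_op z f"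
proof -
  interpret I: ideal "mps_max_pow N" mps_ring
    by (rule ideal_mps_max_pow)
  interpret Q: ring "jet_ring N"
    unfolding jet_ring_def by (rule I.quotient_is_ring)
  have closed: "mps_max_pow N +>\<^bsub>mps_ring\<^esub> f \<in> carrier (jet_ring N)" for f
    using ring_hom_memE(1)[OF I.rcos_ring_hom] by (simp add: jet_ring_def)
  have "jet_rep N z (mps_max_pow N +>\<^bsub>mps_ring\<^esub> f) =
    (\<Oplus>\<^bsub>jet_ring N\<^esub>C\<in>Poly_Mapping.keys z.
      [Poly_Mapping.lookup z C] \<cdot>\<^bsub>jet_ring N\<^esub> (mps_max_pow N +>\<^bsub>mps_ring\<^esub> jet_lift C f))"
    unfolding jet_rep_def
    by (rule Q.finsum_cong') (use assms closed in \<open>auto simp: jet_action_coset subset_iff\<close>)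
  then show ?thesis
    by (simp add: jet_ring_combination jet_op_def)
qed

lemma jet_op_zero [simp]: "jet_op 0 f = 0"
  and jet_op_of [simp]: "jet_op (frag_of C) f = jet_lift C f"
  by (simp_all add: jet_op_def)

lemma jet_op_diff: "jet_op (y - z) f = jet_op y f - jet_op z f"
proof -
  let ?K = "Poly_Mapping.keys y \<union> Poly_Mapping.keys z"
  have "jet_op x f = (\<Sum>C\<in>?K. of_int (Poly_Mapping.lookup x C) * jet_lift C f)"
    if "Poly_Mapping.keys x \<subseteq> ?K" for x
    unfolding jet_op_def
    by (rule sum.mono_neutral_left) (use that in \<open>auto simp: in_keys_iff\<close>)
  then show ?thesis
    using keys_diff[of y z] by (simp add: lookup_minus left_diff_distrib sum_subtractf)
qed

lemma jet_op_diff_right: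
  assumes "Poly_Mapping.keys z \<subseteq> carrier (jet_group N)"
  shows "jet_op z (f - h) = jet_op z f - jet_op z h"
  using assms
proof (induction z rule: frag_induction)
  case (one C)
  then show ?case
    by (simp add: adic_endomorphism.diff vol_group_endomorphism jet_lift_closed)
qed (simp_all add: jet_op_diff)

lemma jet_op_max_pow:
  assumes "Poly_Mapping.keys z \<subseteq> carrier (jet_group N)" "f \<in> mps_max_pow s"
  shows "jet_op z f \<in> mps_max_pow s"
  using assms(1)
proof (induction z rule: frag_induction)
  case (one C)
  then show ?case
    using assms(2) by (simp add: adic_endomorphism.max_pow vol_group_endomorphism jet_lift_closed)
qed (simp_all add: jet_op_diff mps_max_pow_diff)

text \<open>Biadditivity reduces to two cosets; there the representative of the product and the
  composite of the representatives lie in the same coset, hence agree modulo m^N.\<close>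

lemma jet_op_mult:
  assumes "Poly_Mapping.keys y \<subseteq> carrier (jet_group N)" "Poly_Mapping.keys z \<subseteq> carrier (jet_group N)"
  shows "jet_op (y \<otimes>\<^bsub>group_ring (jet_group N)\<^esub> z) f - jet_op y (jet_op z f) \<in> mps_max_pow N"
  using assms(1)
proof (induction y rule: frag_induction)
  case (one C)
  have C: "Poly_Mapping.keys (frag_of C) \<subseteq> carrier (jet_group N)"
    using one by simp
  show ?case
    using assms(2)
  proof (induction z rule: frag_induction)
    case zero
    then show ?case
      using jet_op_diff_right[OF C, of 0 0] by simp
  next
    case (one D)
    then show ?case
      using \<open>C \<in> carrier (jet_group N)\<close> by (simp add: jet_lift_mult)
  next
    case (diff y z)
    have "jet_op (frag_of C \<otimes>\<^bsub>group_ring (jet_group N)\<^esub> (y - z)) f - jet_op (frag_of C) (jet_op (y - z) f) =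
        (jet_op (frag_of C \<otimes>\<^bsub>group_ring (jet_group N)\<^esub> y) f - jet_op (frag_of C) (jet_op y f)) -
        (jet_op (frag_of C \<otimes>\<^bsub>group_ring (jet_group N)\<^esub> z) f - jet_op (frag_of C) (jet_op z f))"
      by (simp only: group_ring_mult_diff jet_op_diff jet_op_diff_right[OF C]) simp
    also have "\<dots> \<in> mps_max_pow N"
      using diff by (rule mps_max_pow_diff)
    finally show ?case .
  qed
next
  case (diff x y)
  have "jet_op ((x - y) \<otimes>\<^bsub>group_ring (jet_group N)\<^esub> z) f - jet_op (x - y) (jet_op z f) =
      (jet_op (x \<otimes>\<^bsub>group_ring (jet_group N)\<^esub> z) f - jet_op x (jet_op z f)) -
      (jet_op (y \<otimes>\<^bsub>group_ring (jet_group N)\<^esub> z) f - jet_op y (jet_op z f))"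
    by (simp add: group_ring_diff_mult jet_op_diff)
  also have "\<dots> \<in> mps_max_pow N"
    using diff by (rule mps_max_pow_diff)
  finally show ?case .
qed simp

text \<open>The condition defining \<open>jet_ideal\<close>, transported from B_N to
  \<open>A\<close>. The cap at N absorbs the dependence of \<open>jet_op\<close> on the chosen
  representatives.\<close>

definition jet_shift :: "nat \<Rightarrow> nat \<Rightarrow> (('n::finite, 'k::comm_ring_1) mps_map set \<Rightarrow>\<^sub>0 int) \<Rightarrow> bool"
  where "jet_shift N a z \<longleftrightarrow> (\<forall>q. \<forall>f\<in>mps_max_pow q. jet_op z f \<in> mps_max_pow (min (q + a) N))"

lemma jet_shift_iff:
  fixes z :: "('n::finite, 'k::comm_ring_1) mps_map set \<Rightarrow>\<^sub>0 int"
  assumes z: "Poly_Mapping.keys z \<subseteq> carrier (jet_group N)"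
  shows "jet_shift N a z \<longleftrightarrow> (\<forall>q. jet_rep N z ` jet_filtration N q \<subseteq> jet_filtration N (q + a))"
proof
  assume shift: "jet_shift N a z"
  show "\<forall>q. jet_rep N z ` jet_filtration N q \<subseteq> jet_filtration N (q + a)"
  proof (intro allI subsetI)
    fix q b
    assume "b \<in> jet_rep N z ` jet_filtration N q"
    then obtain f where f: "f \<in> mps_max_pow (min q N)"
      and b: "b = jet_rep N z (mps_max_pow N +>\<^bsub>mps_ring\<^esub> f)"
      by (auto simp: jet_filtration_eq)
    have "jet_op z f \<in> mps_max_pow (min (min q N + a) N)"
      using shift f by (simp add: jet_shift_def)
    \<comment> \<open>For q beyond N the class of f is zero; both exponents are then N, so capping q
      first loses nothing.\<close>
    moreover have "min (min q N + a) N = min (q + a) N"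
      by simp
    ultimately show "b \<in> jet_filtration N (q + a)"
      by (simp add: b jet_rep_coset[OF z] jet_filtration_coset_iff)
  qed
next
  assume filt: "\<forall>q. jet_rep N z ` jet_filtration N q \<subseteq> jet_filtration N (q + a)"
  show "jet_shift N a z"
    unfolding jet_shift_def
  proof (intro allI ballI)
    fix q and f :: "('n, 'k) mps"
    assume "f \<in> mps_max_pow q"
    then have "mps_max_pow N +>\<^bsub>mps_ring\<^esub> f \<in> jet_filtration N q"
      using mps_max_pow_antimono[of "min q N" q f] by (simp add: jet_filtration_coset_iff)
    then have "jet_rep N z (mps_max_pow N +>\<^bsub>mps_ring\<^esub> f) \<in> jet_filtration N (q + a)"
      using filt by blast
    then show "jet_op z f \<in> mps_max_pow (min (q + a) N)"
      by (simp add: jet_rep_coset[OF z] jet_filtration_coset_iff)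
  qed
qed

lemma jet_ideal_iff:
  "z \<in> jet_ideal N a \<longleftrightarrow>
    Poly_Mapping.keys z \<subseteq> carrier (jet_group N) \<and> augmentation z = 0 \<and> jet_shift N a z"
  using jet_shift_iff[of z N a] by (auto simp only: jet_ideal_def aug_ideal_def group_ring_simps mem_Collect_eq)

lemma jet_shift_zero_weight:
  "Poly_Mapping.keys z \<subseteq> carrier (jet_group N) \<Longrightarrow> jet_shift N 0 z"
  unfolding jet_shift_def
  by (intro allI ballI mps_max_pow_antimono[OF _ jet_op_max_pow]) auto

lemma jet_shift_zero [simp]: "jet_shift N a 0"
  by (simp add: jet_shift_def)

lemma jet_shift_diff: "jet_shift N a y \<Longrightarrow> jet_shift N a z \<Longrightarrow> jet_shift N a (y - z)"
  by (simp add: jet_shift_def jet_op_diff mps_max_pow_diff)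

lemma jet_shift_antimono: "a \<le> b \<Longrightarrow> jet_shift N b z \<Longrightarrow> jet_shift N a z"
  unfolding jet_shift_def by (meson add_left_mono min.mono mps_max_pow_antimono order_refl)

lemma jet_shift_mult:
  fixes y z :: "('n::finite, 'k::comm_ring_1) mps_map set \<Rightarrow>\<^sub>0 int"
  assumes y: "Poly_Mapping.keys y \<subseteq> carrier (jet_group N)" "jet_shift N a y"
    and z: "Poly_Mapping.keys z \<subseteq> carrier (jet_group N)" "jet_shift N b z"
  shows "jet_shift N (a + b) (y \<otimes>\<^bsub>group_ring (jet_group N)\<^esub> z)"
  unfolding jet_shift_def
proof (intro allI ballI)
  fix q and f :: "('n, 'k) mps"
  assume "f \<in> mps_max_pow q"
  then have "jet_op z f \<in> mps_max_pow (min (q + b) N)"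
    using z(2) by (simp add: jet_shift_def)
  then have "jet_op y (jet_op z f) \<in> mps_max_pow (min (min (q + b) N + a) N)"
    using y(2) by (simp add: jet_shift_def)
  then have "jet_op y (jet_op z f) \<in> mps_max_pow (min (q + (a + b)) N)"
    by (rule mps_max_pow_antimono[rotated]) auto
  moreover have "jet_op (y \<otimes>\<^bsub>group_ring (jet_group N)\<^esub> z) f - jet_op y (jet_op z f)
      \<in> mps_max_pow (min (q + (a + b)) N)"
    using jet_op_mult[OF y(1) z(1)] by (rule mps_max_pow_antimono[rotated]) simp
  ultimately show "jet_op (y \<otimes>\<^bsub>group_ring (jet_group N)\<^esub> z) f \<in> mps_max_pow (min (q + (a + b)) N)"
    using mps_max_pow_add by fastforce
qed

section \<open>Ideal properties of the jet filtration\<close>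

lemma jet_ideal_diff: "y \<in> jet_ideal N a \<Longrightarrow> z \<in> jet_ideal N a \<Longrightarrow> y - z \<in> jet_ideal N a"
  using keys_diff[of y z] by (auto simp: jet_ideal_iff jet_shift_diff)

lemma jet_ideal_zero: "0 \<in> jet_ideal N a"
  by (simp add: jet_ideal_iff)

lemma jet_ideal_mult:
  "y \<in> jet_ideal N a \<Longrightarrow> z \<in> jet_ideal N b \<Longrightarrow> y \<otimes>\<^bsub>group_ring (jet_group N)\<^esub> z \<in> jet_ideal N (a + b)"
  by (simp add: jet_ideal_iff jet_group.group_ring_mult_keys augmentation_mult jet_shift_mult)

lemma jet_ideal_antimono: "a \<le> b \<Longrightarrow> jet_ideal N b \<subseteq> jet_ideal N a"
  unfolding subset_iff jet_ideal_iff by (blast intro: jet_shift_antimono)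

text \<open>An arbitrary group ring element preserves the filtration, that is, has shift 0, so
  products keep shift a; their augmentation vanishes because that of one factor does.\<close>

lemma jet_ideal_ideal: "ideal (jet_ideal N a) (group_ring (jet_group N))"
proof (rule jet_group.group_ring_idealI)
  fix x y :: "('a, 'b) mps_map set \<Rightarrow>\<^sub>0 int"
  assume x: "x \<in> jet_ideal N a" and y: "Poly_Mapping.keys y \<subseteq> carrier (jet_group N)"
  show "y \<otimes>\<^bsub>group_ring (jet_group N)\<^esub> x \<in> jet_ideal N a"
    using x y jet_shift_mult[of y N 0 x a] jet_shift_zero_weight[OF y]
    by (simp add: jet_ideal_iff jet_group.group_ring_mult_keys augmentation_mult)
  show "x \<otimes>\<^bsub>group_ring (jet_group N)\<^esub> y \<in> jet_ideal N a"
    using x y jet_shift_mult[of x N a y 0] jet_shift_zero_weight[OF y]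
    by (simp add: jet_ideal_iff jet_group.group_ring_mult_keys augmentation_mult)
qed (auto simp: jet_ideal_zero jet_ideal_diff, auto simp: jet_ideal_iff)

section \<open>Comparison of the weighted and the jet filtration\<close>

interpretation jet_weight: weighted_group
  "jet_group N :: ('n::finite, 'k::comm_ring_1) mps_map set monoid" "jet_weight N"
proof
  show "jet_weight N b \<subseteq> (carrier (jet_group N) :: ('n, 'k) mps_map set set)" for b
    by (auto simp: jet_weight_def jet_subgroup_def jet_group_carrier vol_subgroup_def)
  show "jet_weight N 1 = (carrier (jet_group N) :: ('n, 'k) mps_map set set)"
    by (simp add: jet_weight_def jet_subgroup_def jet_group_carrier vol_subgroup_le_2)
qed

lemma jet_shift_diff_of:
  fixes C :: "('n::finite, 'k::comm_ring_1) mps_map set"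
  assumes "C \<in> jet_weight N a"
  shows "jet_shift N a (group_ring_diff (jet_group N) C)"
  unfolding jet_shift_def
proof (intro allI ballI)
  fix q and f :: "('n, 'k) mps"
  assume f: "f \<in> mps_max_pow q"
  obtain g where g: "g \<in> vol_subgroup (Suc a)" "C = vol_subgroup N #>\<^bsub>vol_group\<^esub> g"
    using assms by (auto simp: jet_weight_def jet_subgroup_def)
  let ?M = "mps_max_pow (min (q + a) N)"
  have "jet_lift C f - g f \<in> ?M"
  proof (rule mps_max_pow_antimono)
    show "jet_lift C f - g f \<in> mps_max_pow N"
      using g by (simp add: jet_lift_coset(2) vol_subgroup_iff)
  qed simp
  moreover have "g f - f \<in> ?M"
    using vol_subgroup_max_pow_diff[OF g(1) f] by (rule mps_max_pow_antimono[rotated]) simp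
  moreover have "jet_lift \<one>\<^bsub>jet_group N\<^esub> f - f \<in> ?M"
    using jet_lift_one by (rule mps_max_pow_antimono[rotated]) simp
  \<comment> \<open>The genuine estimate is for g in G_(a+1); the outer terms exchange g and
    \<open>id\<close> for the representatives chosen for C and for the unit.\<close>
  ultimately have "(jet_lift C f - g f) + (g f - f) - (jet_lift \<one>\<^bsub>jet_group N\<^esub> f - f) \<in> ?M"
    by (rule mps_max_pow_diff[OF mps_max_pow_add])
  then show "jet_op (group_ring_diff (jet_group N) C) f \<in> ?M"
    by (simp add: jet_group.group_ring_diff_eq jet_op_diff)
qed

lemma jet_shift_weighted_product:
  assumes "\<forall>(b, h)\<in>set bhs. h \<in> jet_weight N b"
  shows "jet_shift N (sum_list (map fst bhs)) (weighted_product (jet_group N) bhs)"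
  using assms
proof (induction bhs)
  case Nil
  then show ?case
    by (simp add: jet_weight.weighted_product_Nil jet_shift_zero_weight)
next
  case (Cons bh bhs)
  obtain b h where bh: "bh = (b, h)"
    by force
  have "snd ` set bhs \<subseteq> carrier (jet_group N)" "h \<in> carrier (jet_group N)"
    using Cons.prems jet_weight.weight_closed by (fastforce simp: bh)+
  then show ?case
    using Cons jet_shift_diff_of[of h N b]
    by (simp add: bh jet_weight.weighted_product_Cons jet_shift_mult
        jet_group.group_ring_diff_keys jet_weight.weighted_product_keys)
qed

lemma weighted_ideal_subset_jet_ideal:
  assumes "1 \<le> a"
  shows "weighted_ideal (jet_group N) (jet_weight N) a \<subseteq> jet_ideal N a"
proof
  fix x
  assume x: "x \<in> weighted_ideal (jet_group N) (jet_weight N) a"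
  then have "x \<in> aug_ideal (jet_group N)"
    using jet_weight.weighted_ideal_antimono[OF assms] jet_weight.weighted_ideal_one by blast
  moreover have "jet_shift N a x"
    using x
  proof (induction rule: jet_weight.weighted_ideal_induct)
    case (product bhs)
    then have "jet_shift N (sum_list (map fst bhs)) (weighted_product (jet_group N) bhs)"
      by (intro jet_shift_weighted_product) (auto simp: weighted_list_def)
    then show ?case
      using product by (auto simp: weighted_list_def intro: jet_shift_antimono)
  qed (simp_all add: jet_shift_diff)
  ultimately show "x \<in> jet_ideal N a"
    by (simp add: jet_ideal_iff aug_ideal_def)
qed

lemma dim_subgroup_jet_ideal_subset: "dim_subgroup (jet_group N) (jet_ideal N a) \<subseteq> jet_weight N a"
proof
  fix C
  assume "C \<in> dim_subgroup (jet_group N) (jet_ideal N a)"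
  then have C: "C \<in> carrier (jet_group N)" and shift: "jet_shift N a (group_ring_diff (jet_group N) C)"
    by (auto simp: dim_subgroup_def jet_ideal_iff)
  let ?g = "jet_lift C"
  have g: "?g \<in> carrier vol_group"
    using C by (rule jet_lift_closed)
  have gX: "?g (mps_X j) - mps_X j \<in> mps_max_pow (min (Suc a) N)" for j
  proof -
    have "?g (mps_X j) - jet_lift \<one>\<^bsub>jet_group N\<^esub> (mps_X j) \<in> mps_max_pow (min (Suc 0 + a) N)"
      using shift mps_X_in_max_pow[of j] unfolding jet_shift_def
      by (fastforce simp: jet_group.group_ring_diff_eq jet_op_diff)
    moreover have "jet_lift \<one>\<^bsub>jet_group N\<^esub> (mps_X j) - mps_X j \<in> mps_max_pow (min (Suc 0 + a) N)"
      using jet_lift_one by (rule mps_max_pow_antimono[rotated]) simp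
    ultimately show ?thesis
      using mps_max_pow_add by fastforce
  qed
  show "C \<in> jet_weight N a"
  \<comment> \<open>The jets determine g only modulo m^N. If a + 1 exceeds N, one gets merely g in
    G_N, but then C is the unit coset, which is also the class of \<open>id\<close> in
    G_(a+1).\<close>
  proof (cases "Suc a \<le> N")
    case True
    then have "?g \<in> vol_subgroup (Suc a)"
      using g gX by (simp add: vol_subgroup_def min_def)
    then show ?thesis
      using jet_lift_coset_eq[OF C] by (force simp: jet_weight_def jet_subgroup_def)
  next
    case False
    then have "?g \<in> vol_subgroup N"
      using g gX by (simp add: vol_subgroup_def min_def)
    then have "C = vol_subgroup N #>\<^bsub>vol_group\<^esub> id"
      using vol_subgroup_coset_eqI[OF g vol_group_id_closed, of N] jet_lift_coset_eq[OF C]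
      by (simp add: vol_subgroup_iff)
    moreover have "id \<in> vol_subgroup (Suc a)"
      by (simp add: vol_subgroup_iff vol_group_id_closed)
    ultimately show ?thesis
      by (auto simp: jet_weight_def jet_subgroup_def)
  qed
qed

text \<open>Passing to the quotient replaces each representative by one congruent to it modulo m^N,
  so \<open>jet_op\<close> changes only within m^N. The cap N' weakens to N, and push-forward keeps
  the augmentation even when basis elements merge.\<close>

lemma group_ring_map_jet_ideal:
  fixes z :: "('n::finite, 'k::comm_ring_1) mps_map set \<Rightarrow>\<^sub>0 int"
  assumes "N \<le> N'" and z: "z \<in> jet_ideal N' a"
  shows "group_ring_map (jet_quotient N) z \<in> jet_ideal N a"
proof -
  let ?z = "group_ring_map (jet_quotient N) z"
  have keys: "Poly_Mapping.keys z \<subseteq> carrier (jet_group N')"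
    using z by (simp add: jet_ideal_iff)
  have quotient: "jet_quotient N C \<in> carrier (jet_group N)"
    "jet_lift (jet_quotient N C) f - jet_lift C f \<in> mps_max_pow N" if "C \<in> carrier (jet_group N')" for C f
    using jet_lift_closed[OF that] jet_lift_coset(2)[OF jet_lift_closed[OF that]]
    by (auto simp: jet_quotient_eq[OF that assms(1)] jet_group_carrier)
  have keys': "Poly_Mapping.keys ?z \<subseteq> carrier (jet_group N)"
  proof -
    have "Poly_Mapping.keys ?z \<subseteq> (\<Union>C\<in>Poly_Mapping.keys z. Poly_Mapping.keys (frag_of (jet_quotient N C)))"
      unfolding group_ring_map_def by (rule keys_frag_extend)
    also have "\<dots> \<subseteq> carrier (jet_group N)"
      using keys quotient(1) by auto
    finally show ?thesis .
  qed
  have cong: "jet_op ?z f - jet_op z f \<in> mps_max_pow N" for f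
    using keys
  proof (induction z rule: frag_induction)
    case (one C)
    then show ?case
      by (simp add: group_ring_map_def quotient)
  next
    case (diff y z)
    let ?m = "group_ring_map (jet_quotient N)"
    have "jet_op (?m (y - z)) f - jet_op (y - z) f =
        (jet_op (?m y) f - jet_op y f) - (jet_op (?m z) f - jet_op z f)"
      by (simp add: group_ring_map_def frag_extend_diff jet_op_diff)
    also have "\<dots> \<in> mps_max_pow N"
      using diff by (rule mps_max_pow_diff)
    finally show ?case .
  qed (simp add: group_ring_map_def)
  have "jet_shift N a ?z"
    unfolding jet_shift_def
  proof (intro allI ballI)
    fix q and f :: "('n, 'k) mps"
    assume "f \<in> mps_max_pow q"
    then have "jet_op z f \<in> mps_max_pow (min (q + a) N')"
      using z by (simp add: jet_ideal_iff jet_shift_def)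
    then have "jet_op z f \<in> mps_max_pow (min (q + a) N)"
      by (rule mps_max_pow_antimono[rotated]) (use assms(1) in auto)
    moreover have "jet_op ?z f - jet_op z f \<in> mps_max_pow (min (q + a) N)"
      using cong by (rule mps_max_pow_antimono[rotated]) simp
    ultimately show "jet_op ?z f \<in> mps_max_pow (min (q + a) N)"
      using mps_max_pow_add by fastforce
  qed
  moreover have "augmentation ?z = 0"
    using z by (simp add: jet_ideal_iff group_ring_map_def augmentation_extend_of)
  ultimately show ?thesis
    using keys' by (simp add: jet_ideal_iff)
qed

theorem theorem1p1:
  fixes N :: nat
    and T :: "nat \<Rightarrow> ('n::finite, 'p::prime_card mod_ring) mps_map set monoid"
    and H :: "nat \<Rightarrow> nat \<Rightarrow> ('n, 'p mod_ring) mps_map set set"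
    and \<A> \<I> :: "nat \<Rightarrow> nat \<Rightarrow> (('n, 'p mod_ring) mps_map set \<Rightarrow>\<^sub>0 int) set"
  defines "T \<equiv> jet_group"
    and "H \<equiv> jet_weight"
    and "\<A> \<equiv> (\<lambda>N. weighted_ideal (T N) (H N))"
    and "\<I> \<equiv> jet_ideal"
  assumes p: "CARD('p) \<ge> 5" and n: "CARD('n) \<ge> 3" and N: "N \<ge> 3"
  shows
    "(aug_ideal (T N) = \<A> N 1
      \<and> (\<forall>a\<ge>1. \<A> N (a + 1) \<subseteq> \<A> N a)
      \<and> (\<forall>a\<ge>1. ideal (\<A> N a) (group_ring (T N)))
      \<and> (\<forall>a\<ge>1. \<forall>b\<ge>1. \<A> N a \<cdot>\<^bsub>group_ring (T N)\<^esub> \<A> N b \<subseteq> \<A> N (a + b))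
      \<and> (\<forall>a\<ge>1. dim_subgroup (T N) (\<A> N a) = H N a \<and> H N a = jet_subgroup N (a + 1)))
   \<and> (aug_ideal (T N) = \<I> N 1
      \<and> (\<forall>a\<ge>1. \<I> N (a + 1) \<subseteq> \<I> N a)
      \<and> (\<forall>a\<ge>1. ideal (\<I> N a) (group_ring (T N)))
      \<and> (\<forall>a\<ge>1. \<forall>b\<ge>1. \<I> N a \<cdot>\<^bsub>group_ring (T N)\<^esub> \<I> N b \<subseteq> \<I> N (a + b))
      \<and> (\<forall>a\<ge>1. \<A> N a \<subseteq> \<I> N a \<and> dim_subgroup (T N) (\<I> N a) = jet_subgroup N (a + 1)))
   \<and> (\<forall>N'\<ge>N. \<forall>a\<ge>1. group_ring_map (jet_quotient N) ` \<I> N' a \<subseteq> \<I> N a)"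
proof -
  have A_one: "aug_ideal (T N) = \<A> N 1"
    unfolding T_def H_def \<A>_def by (rule jet_weight.weighted_ideal_one[symmetric])
  have A_I: "\<A> N a \<subseteq> \<I> N a" if "1 \<le> a" for a
    unfolding T_def H_def \<A>_def \<I>_def using that by (rule weighted_ideal_subset_jet_ideal)
  have I_aug: "\<I> N a \<subseteq> aug_ideal (T N)" for a
    by (auto simp: \<I>_def T_def jet_ideal_def)
  have A_decr: "\<A> N (a + 1) \<subseteq> \<A> N a" for a
    unfolding T_def H_def \<A>_def by (rule jet_weight.weighted_ideal_antimono) simp
  have A_mult: "\<A> N a \<cdot>\<^bsub>group_ring (T N)\<^esub> \<A> N b \<subseteq> \<A> N (a + b)" for a b
    unfolding T_def H_def \<A>_def
    by (intro jet_group.group_ring_ideal_prod_subset jet_weight.weighted_ideal_mult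
        jet_weight.weighted_ideal_diff jet_weight.weighted_ideal_zero)
  have I_mult: "\<I> N a \<cdot>\<^bsub>group_ring (T N)\<^esub> \<I> N b \<subseteq> \<I> N (a + b)" for a b
    unfolding T_def \<I>_def
    by (intro jet_group.group_ring_ideal_prod_subset jet_ideal_mult jet_ideal_diff jet_ideal_zero)
  have I_decr: "\<I> N (a + 1) \<subseteq> \<I> N a" for a
    unfolding \<I>_def by (rule jet_ideal_antimono) simp
  have dim_I: "dim_subgroup (T N) (\<I> N a) \<subseteq> H N a" for a
    unfolding T_def H_def \<I>_def by (rule dim_subgroup_jet_ideal_subset)
  have dim_A: "H N a \<subseteq> dim_subgroup (T N) (\<A> N a)" if "1 \<le> a" for a
    unfolding T_def H_def \<A>_def using jet_weight.weight_closed jet_weight.weighted_ideal_diff_of[OF that]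
    by (auto simp: dim_subgroup_def)
  \<comment> \<open>\<open>dim_subgroup\<close> is monotone in the ideal, so \<open>A_I\<close>
    closes a circle of inclusions and yields both equalities at once.\<close>
  have dim: "dim_subgroup (T N) (\<A> N a) = H N a" "dim_subgroup (T N) (\<I> N a) = H N a" if "1 \<le> a" for a
    using dim_I[of a] dim_A[OF that] A_I[OF that] by (auto simp: dim_subgroup_def)
  have H_eq: "H N a = jet_subgroup N (a + 1)" for a
    by (simp add: H_def jet_weight_def)
  \<comment> \<open>Again a sandwich: the augmentation ideal equals A_1, which lies in I_1, which
    lies in the augmentation ideal by definition.\<close>
  have I_one: "aug_ideal (T N) = \<I> N 1"
    using A_one A_I[of 1] I_aug[of 1] by auto
  have A_ideal: "ideal (\<A> N a) (group_ring (T N))" for a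
    unfolding T_def H_def \<A>_def by (rule jet_weight.weighted_ideal_ideal)
  have I_ideal: "ideal (\<I> N a) (group_ring (T N))" for a
    unfolding T_def \<I>_def by (rule jet_ideal_ideal)
  have quotient: "group_ring_map (jet_quotient N) ` \<I> N' a \<subseteq> \<I> N a" if "N \<le> N'" for N' a
    unfolding \<I>_def using group_ring_map_jet_ideal[OF that] by blast
  show ?thesis
    by (intro conjI allI impI A_one A_decr A_ideal A_mult I_one I_decr I_ideal I_mult A_I quotient)
      (simp_all add: dim H_eq)
qed

end
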